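(* Let $\Lambda/\Lambda_1/\cdots/\Lambda_{r-1}/\Lambda'$ be a self-similar binary lattice partition chain in $\mathbb R^n$, let $\sigma>0$, let $N=2^m$, and let $W_\ell$ be the $\Lambda_{\ell-1}/\Lambda_\ell$ channel with noise variance $\sigma^2$, $1\le\ell\le r$. Let $\tau>0$ be a threshold common to all levels, and let the component polar codes be chosen by the equal-error-probability rule, based either on the Bhattacharyya parameter, $\mathcal I_\ell=\{i:Z(W_{\ell,N}^{(i)})<\tau\}$ for all $\ell$, or on the error probability, $\mathcal I_\ell=\{i:P_e(W_{\ell,N}^{(i)})<\tau\}$ for all $\ell$. Let $k_\ell=|\mathcal I_\ell|$ and let $\mathcal P(N,k_\ell)$ be the polar code of length $N$ with information set $\mathcal I_\ell$. Then the component polar codes are nested: $$\mathcal P(N,k_1)\subseteq\mathcal P(N,k_2)\subseteq\cdots\subseteq\mathcal P(N,k_r).$$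
   Context: A self-similar binary lattice partition chain is a chain of full-rank lattices $\Lambda=\Lambda_0\supset\Lambda_1\supset\cdots\supset\Lambda_r=\Lambda'$ with $|\Lambda_{\ell-1}/\Lambda_\ell|=2$ and $\Lambda_\ell=T^\ell\Lambda$, where $T=\alpha V$ with $\alpha>1$ and $V$ orthogonal. Fix $a_\ell\in\Lambda_{\ell-1}\setminus\Lambda_\ell$. The $\Lambda_{\ell-1}/\Lambda_\ell$ channel takes a bit $x$ and outputs $(xa_\ell+E)\bmod\Lambda_\ell$ with $E$ i.i.d. $\mathcal N(0,\sigma^2)$ noise per dimension. For a binary-input channel $W$: $Z(W)=\sum_y\sqrt{W(y|0)W(y|1)}$ and $P_e(W)=\frac12\sum_y\min\{W(y|0),W(y|1)\}$ (integrals for continuous outputs). With $G_N=\begin{bmatrix}1&0\\1&1\end{bmatrix}^{\otimes m}$, the $i$-th subchannel is $W_N^{(i)}(y^{1:N},u^{1:i-1}|u^i)=2^{-(N-1)}\sum_{u^{i+1:N}\in\{0,1\}^{N-i}}\prod_{j=1}^NW(y^j|x^j)$, where $x^{1:N}=u^{1:N}G_N$ over $\mathbb F_2$; $W_{\ell,N}^{(i)}$ denotes the $i$-th subchannel of $W_\ell$. The polar code with information set $\mathcal I$ is the binary linear code spanned by the rows of $G_N$ indexed by $\mathcal I$. *)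

theory Defs
  imports "HOL-Probability.Probability" "HOL-Library.Z2"
begin

section \<open>Lattice partition chains\<close>

definition full_rank_lattice :: "(real^'n) set \<Rightarrow> bool" where
  "full_rank_lattice L \<longleftrightarrow>
     (\<exists>B. independent B \<and> span B = UNIV \<and>
          L = {(\<Sum>b\<in>B. of_int (c b) *\<^sub>R b) | c :: real^'n \<Rightarrow> int. True})"

definition lattice_index :: "(real^'n) set \<Rightarrow> (real^'n) set \<Rightarrow> nat" where
  "lattice_index L L' = card (L // {(x, y). x \<in> L \<and> y \<in> L \<and> x - y \<in> L'})"

definition self_similar_chain :: "(nat \<Rightarrow> (real^'n) set) \<Rightarrow> nat \<Rightarrow> bool" where
  "self_similar_chain \<Lambda> r \<longleftrightarrow>
     (\<forall>l\<le>r. full_rank_lattice (\<Lambda> l)) \<and>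
     (\<forall>l\<in>{1..r}. \<Lambda> l \<subset> \<Lambda> (l - 1) \<and> lattice_index (\<Lambda> (l - 1)) (\<Lambda> l) = 2) \<and>
     (\<exists>\<alpha> V. 1 < \<alpha> \<and> orthogonal_transformation V \<and>
            (\<forall>l\<le>r. \<Lambda> l = ((\<lambda>x. \<alpha> *\<^sub>R V x) ^^ l) ` \<Lambda> 0))"

section \<open>The channel of a lattice partition\<close>

text \<open>Reduction modulo a lattice returns the representative in a Borel fundamental region D;
  the region is a parameter, so no particular choice (Voronoi cell, parallelepiped) is built in.\<close>

definition fundamental_region :: "(real^'n) set \<Rightarrow> (real^'n) set \<Rightarrow> bool" where
  "fundamental_region L D \<longleftrightarrow> D \<in> sets borel \<and> (\<forall>x. \<exists>!y. y \<in> D \<and> x - y \<in> L)"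

definition lattice_mod :: "(real^'n) set \<Rightarrow> (real^'n) set \<Rightarrow> real^'n \<Rightarrow> real^'n" where
  "lattice_mod L D x = (THE y. y \<in> D \<and> x - y \<in> L)"

definition gaussian_noise :: "real \<Rightarrow> (real^'n) measure" where
  "gaussian_noise \<sigma> = density lborel (\<lambda>e. ennreal (\<Prod>i\<in>UNIV. normal_density 0 \<sigma> (e $ i)))"

definition partition_channel ::
  "(real^'n) set \<Rightarrow> (real^'n) set \<Rightarrow> real^'n \<Rightarrow> real \<Rightarrow> bit \<Rightarrow> (real^'n) measure" where
  "partition_channel L D a \<sigma> x =
     distr (gaussian_noise \<sigma>) lborel (\<lambda>e. lattice_mod L D ((if x = 1 then a else 0) + e))"

text \<open>The transition density $W(y|x)$, written \<open>W x y\<close>, with respect to Lebesgue measure.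
  It vanishes almost everywhere outside D.\<close>

definition partition_density ::
  "(real^'n) set \<Rightarrow> (real^'n) set \<Rightarrow> real^'n \<Rightarrow> real \<Rightarrow> bit \<Rightarrow> real^'n \<Rightarrow> real" where
  "partition_density L D a \<sigma> x y = enn2real (RN_deriv lborel (partition_channel L D a \<sigma> x) y)"

section \<open>Binary-input channels\<close>

text \<open>A binary-input channel is given by its transition density \<open>W x y\<close> with respect to a
  reference measure \<open>M\<close> on the output alphabet (counting measure for discrete outputs).\<close>

definition bhattacharyya :: "'y measure \<Rightarrow> (bit \<Rightarrow> 'y \<Rightarrow> real) \<Rightarrow> real" where
  "bhattacharyya M W = (LINT y|M. sqrt (W 0 y * W 1 y))"

definition error_probability :: "'y measure \<Rightarrow> (bit \<Rightarrow> 'y \<Rightarrow> real) \<Rightarrow> real" where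
  "error_probability M W = 1 / 2 * (LINT y|M. min (W 0 y) (W 1 y))"

section \<open>Polar codes\<close>

text \<open>Positions are numbered \<open>0, \<dots>, 2 ^ m - 1\<close>.
  \<open>polar_matrix m\<close> is the m-fold Kronecker power of the kernel.\<close>

definition polar_kernel :: "nat \<Rightarrow> nat \<Rightarrow> bit" where
  "polar_kernel i j = (if i = 0 \<and> j = 1 then 0 else 1)"

primrec polar_matrix :: "nat \<Rightarrow> nat \<Rightarrow> nat \<Rightarrow> bit" where
  "polar_matrix 0 i j = 1"
| "polar_matrix (Suc m) i j =
     polar_kernel (i div 2 ^ m) (j div 2 ^ m) * polar_matrix m (i mod 2 ^ m) (j mod 2 ^ m)"

definition polar_encode :: "nat \<Rightarrow> (nat \<Rightarrow> bit) \<Rightarrow> nat \<Rightarrow> bit" where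
  "polar_encode m u j = (\<Sum>i<2 ^ m. u i * polar_matrix m i j)"

text \<open>The outputs of the i-th subchannel are pairs of the channel outputs and the past bits
  \<open>u 0, \<dots>, u (i - 1)\<close>; in its transition density the bits after position i are averaged out.\<close>

definition subchannel_output :: "nat \<Rightarrow> nat \<Rightarrow> 'y measure \<Rightarrow> ((nat \<Rightarrow> 'y) \<times> (nat \<Rightarrow> bit)) measure" where
  "subchannel_output m i M =
     (\<Pi>\<^sub>M j\<in>{..<2 ^ m}. M) \<Otimes>\<^sub>M count_space ({..<i} \<rightarrow>\<^sub>E {0, 1})"

definition subchannel ::
  "nat \<Rightarrow> nat \<Rightarrow> (bit \<Rightarrow> 'y \<Rightarrow> real) \<Rightarrow> bit \<Rightarrow> (nat \<Rightarrow> 'y) \<times> (nat \<Rightarrow> bit) \<Rightarrow> real" where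
  "subchannel m i W b = (\<lambda>(y, u).
     1 / 2 ^ (2 ^ m - 1) *
     (\<Sum>v \<in> {i + 1..<2 ^ m} \<rightarrow>\<^sub>E {0, 1}.
        \<Prod>j<2 ^ m. W (polar_encode m (\<lambda>k. if k < i then u k else if k = i then b else v k) j) (y j)))"

definition info_set_Z :: "nat \<Rightarrow> 'y measure \<Rightarrow> (bit \<Rightarrow> 'y \<Rightarrow> real) \<Rightarrow> real \<Rightarrow> nat set" where
  "info_set_Z m M W \<tau> =
     {i. i < 2 ^ m \<and> bhattacharyya (subchannel_output m i M) (subchannel m i W) < \<tau>}"

definition info_set_Pe :: "nat \<Rightarrow> 'y measure \<Rightarrow> (bit \<Rightarrow> 'y \<Rightarrow> real) \<Rightarrow> real \<Rightarrow> nat set" where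
  "info_set_Pe m M W \<tau> =
     {i. i < 2 ^ m \<and> error_probability (subchannel_output m i M) (subchannel m i W) < \<tau>}"

text \<open>Codewords are functions on \<open>{..<2 ^ m}\<close>, extended by \<open>undefined\<close>.\<close>

definition polar_code :: "nat \<Rightarrow> nat set \<Rightarrow> (nat \<Rightarrow> bit) set" where
  "polar_code m I =
     {(\<lambda>j\<in>{..<2 ^ m}. \<Sum>i\<in>I. c i * polar_matrix m i j) | c :: nat \<Rightarrow> bit. True}"

end

(*
  Reduction modulo the chain shows that the (l+1)-st channel, scaled by the similarity T^{-1},
  is the l-th channel with the smaller noise standard deviation sigma / alpha. Adding independent
  Gaussian noise and reducing again turns it into the l-th channel, so the l-th channel is
  stochastically degraded with respect to the (l+1)-st. Degradation passes to the polar
  subchannels, and it can only increase Z and P_e because sqrt (p q) and min p q are infima of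
  linear functions of (p, q). Hence the information sets increase with l.
*)
theory Submission
  imports Defs
begin

section \<open>Degraded channels\<close>

text \<open>Two obstacles shape the proof. A partition channel is known only through a Radon-Nikodym
  density, fixed up to null sets, so degradation is stated as an equality of measures and not as a
  pointwise identity of densities. It must also survive N-fold products and the past bits: hence it
  is encoded by a map \<open>\<phi>\<close> of the better output and an independent noise variable
  of law \<open>K\<close>, and N uses of the channel simply take N independent copies of
  \<open>K\<close>. In the locale, \<open>W\<close> is the better channel and \<open>W'\<close> the
  degraded one. On the lattice side, the data at level l + 1 need not be the image under T of the
  data at level l: the region \<open>D (l + 1)\<close> is arbitrary, and \<open>a (l + 1)\<close>
  may differ from T applied to \<open>a l\<close>. The region drops out because the kernel reduces
  modulo \<open>\<Lambda> l\<close> afterwards, the representative because index 2 makes all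
  admissible choices congruent. Orthogonality of V keeps the noise isotropic, and \<alpha> > 1
  leaves a positive variance to be added.\<close>

locale degraded_channel =
  fixes M :: "'y measure" and W :: "bit \<Rightarrow> 'y \<Rightarrow> real"
    and M' :: "'z measure" and W' :: "bit \<Rightarrow> 'z \<Rightarrow> real"
    and K :: "'k measure" and \<phi> :: "'y \<times> 'k \<Rightarrow> 'z"
  assumes sigma_finite: "sigma_finite_measure M" "sigma_finite_measure M'"
    and noise: "prob_space K"
    and measurable_map [measurable]: "\<phi> \<in> M \<Otimes>\<^sub>M K \<rightarrow>\<^sub>M M'"
    and measurable_W [measurable]: "W b \<in> borel_measurable M"
    and measurable_W' [measurable]: "W' b \<in> borel_measurable M'"
    and nonneg: "0 \<le> W b y" "0 \<le> W' b z"
    and finite: "finite_measure (density M (W b))"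
    and pushforward: "density M' (W' b) = distr (density M (W b) \<Otimes>\<^sub>M K) M' \<phi>"
begin

text \<open>Change of variables and Fubini: averaging a test function over the noise moves it from
  the output of \<open>W'\<close> to the output of \<open>W\<close>. This is the form in which
  \<open>pushforward\<close> enters all comparisons.\<close>

lemma nn_integral_degraded:
  fixes h :: "'z \<Rightarrow> ennreal"
  assumes [measurable]: "h \<in> borel_measurable M'"
  shows "(\<integral>\<^sup>+z. W' b z * h z \<partial>M') = (\<integral>\<^sup>+y. W b y * (\<integral>\<^sup>+k. h (\<phi> (y, k)) \<partial>K) \<partial>M)"
proof -
  interpret K: prob_space K by (rule noise)
  have "(\<integral>\<^sup>+z. W' b z * h z \<partial>M') = (\<integral>\<^sup>+z. h z \<partial>density M' (W' b))"
    by (simp add: nn_integral_density)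
  also have "\<dots> = (\<integral>\<^sup>+p. h (\<phi> p) \<partial>(density M (W b) \<Otimes>\<^sub>M K))"
    unfolding pushforward by (rule nn_integral_distr) simp_all
  also have "\<dots> = (\<integral>\<^sup>+y. \<integral>\<^sup>+k. h (\<phi> (y, k)) \<partial>K \<partial>density M (W b))"
    by (rule K.nn_integral_fst[symmetric]) simp
  also have "\<dots> = (\<integral>\<^sup>+y. W b y * (\<integral>\<^sup>+k. h (\<phi> (y, k)) \<partial>K) \<partial>M)"
    by (simp add: nn_integral_density)
  finally show ?thesis .
qed

lemma nn_integral_degraded_total: "(\<integral>\<^sup>+z. W' b z \<partial>M') = (\<integral>\<^sup>+y. W b y \<partial>M)"
proof -
  interpret K: prob_space K by (rule noise)
  show ?thesis using nn_integral_degraded[of "\<lambda>_. 1" b] by (simp add: K.emeasure_space_1)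
qed

lemma nn_integral_W_finite: "(\<integral>\<^sup>+y. W b y \<partial>M) < \<infinity>"
proof -
  interpret finite_measure "density M (W b)" by (rule finite)
  show ?thesis using emeasure_finite[of "space M"]
    by (simp add: emeasure_density top.not_eq_extremum cong: nn_integral_cong)
qed

text \<open>The hypotheses say that F is, up to \<open>\<epsilon>\<close>, an infimum of linear functions with nonnegative
  coefficients; for such F an integral inequality can be tested on one linear function at a time,
  where degradation acts by composing the coefficients with \<open>\<phi>\<close>.\<close>

lemma nn_integral_data_processing:
  fixes F :: "real \<Rightarrow> real \<Rightarrow> real" and \<alpha> \<beta> :: "real \<Rightarrow> real \<Rightarrow> real \<Rightarrow> real"
  assumes [measurable]: "case_prod F \<in> borel_measurable borel"
    and [measurable]: "\<And>\<epsilon>. case_prod (\<alpha> \<epsilon>) \<in> borel_measurable borel"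
      "\<And>\<epsilon>. case_prod (\<beta> \<epsilon>) \<in> borel_measurable borel"
    and coeff_nonneg: "\<And>\<epsilon> p q. 0 < \<epsilon> \<Longrightarrow> 0 \<le> \<alpha> \<epsilon> p q \<and> 0 \<le> \<beta> \<epsilon> p q"
    and majorant: "\<And>\<epsilon> p q p' q'. 0 < \<epsilon> \<Longrightarrow> 0 \<le> p \<Longrightarrow> 0 \<le> q \<Longrightarrow> 0 \<le> p' \<Longrightarrow> 0 \<le> q' \<Longrightarrow>
      F p' q' \<le> \<alpha> \<epsilon> p q * p' + \<beta> \<epsilon> p q * q'"
    and tight: "\<And>\<epsilon> p q. 0 < \<epsilon> \<Longrightarrow> 0 \<le> p \<Longrightarrow> 0 \<le> q \<Longrightarrow>
      \<alpha> \<epsilon> p q * p + \<beta> \<epsilon> p q * q \<le> F p q + \<epsilon> * (p + q)"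
    and F_nonneg: "\<And>p q. 0 \<le> p \<Longrightarrow> 0 \<le> q \<Longrightarrow> 0 \<le> F p q"
  shows "(\<integral>\<^sup>+y. F (W 0 y) (W 1 y) \<partial>M) \<le> (\<integral>\<^sup>+z. F (W' 0 z) (W' 1 z) \<partial>M')"
proof -
  interpret K: prob_space K by (rule noise)
  have Fm [measurable]: "(\<lambda>y. F (f y) (g y)) \<in> borel_measurable N"
    if [measurable]: "f \<in> borel_measurable N" "g \<in> borel_measurable N" for f g and N :: "'q measure"
    using measurable_compose[of "\<lambda>y. (f y, g y)" N borel, OF _ assms(1)] by (simp add: borel_prod[symmetric])
  have \<alpha>m [measurable]: "(\<lambda>y. \<alpha> \<epsilon> (f y) (g y)) \<in> borel_measurable N"
    if [measurable]: "f \<in> borel_measurable N" "g \<in> borel_measurable N" for f g \<epsilon> and N :: "'q measure"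
    using measurable_compose[of "\<lambda>y. (f y, g y)" N borel, OF _ assms(2)] by (simp add: borel_prod[symmetric])
  have \<beta>m [measurable]: "(\<lambda>y. \<beta> \<epsilon> (f y) (g y)) \<in> borel_measurable N"
    if [measurable]: "f \<in> borel_measurable N" "g \<in> borel_measurable N" for f g \<epsilon> and N :: "'q measure"
    using measurable_compose[of "\<lambda>y. (f y, g y)" N borel, OF _ assms(3)] by (simp add: borel_prod[symmetric])
  define C where "C = (\<integral>\<^sup>+y. W 0 y \<partial>M) + (\<integral>\<^sup>+y. W 1 y \<partial>M)"
  have C: "C < \<infinity>" unfolding C_def using nn_integral_W_finite by simp
  have approx: "(\<integral>\<^sup>+y. F (W 0 y) (W 1 y) \<partial>M) \<le> (\<integral>\<^sup>+z. F (W' 0 z) (W' 1 z) \<partial>M') + ennreal \<epsilon> * C"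
    if \<epsilon>: "0 < \<epsilon>" for \<epsilon>
  proof -
    define A where "A = (\<lambda>z. \<alpha> \<epsilon> (W' 0 z) (W' 1 z))"
    define B where "B = (\<lambda>z. \<beta> \<epsilon> (W' 0 z) (W' 1 z))"
    have [measurable]: "A \<in> borel_measurable M'" "B \<in> borel_measurable M'"
      unfolding A_def B_def by measurable
    have AB: "0 \<le> A z" "0 \<le> B z" for z using coeff_nonneg[OF \<epsilon>] by (auto simp: A_def B_def)
    \<comment> \<open>The coefficients fit the densities at the degraded output
      \<open>\<phi> (y, k)\<close>, not those at \<open>y\<close>. The majorant allows this
      mismatch, for every \<open>k\<close>, so averaging over the noise keeps the bound.\<close>
    have "ennreal (F (W 0 y) (W 1 y)) \<le>
        W 0 y * (\<integral>\<^sup>+k. A (\<phi> (y, k)) \<partial>K) + W 1 y * (\<integral>\<^sup>+k. B (\<phi> (y, k)) \<partial>K)"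
      if [measurable]: "y \<in> space M" for y
    proof -
      have "ennreal (F (W 0 y) (W 1 y)) = (\<integral>\<^sup>+k. F (W 0 y) (W 1 y) \<partial>K)"
        by (simp add: K.emeasure_space_1)
      also have "\<dots> \<le> (\<integral>\<^sup>+k. ennreal (W 0 y) * A (\<phi> (y, k)) + ennreal (W 1 y) * B (\<phi> (y, k)) \<partial>K)"
        using majorant[OF \<epsilon> nonneg(2) nonneg(2) nonneg(1) nonneg(1)] AB nonneg
        by (intro nn_integral_mono)
          (simp add: ennreal_mult[symmetric] ennreal_plus[symmetric] A_def B_def mult.commute
            del: ennreal_plus)
      also have "\<dots> = W 0 y * (\<integral>\<^sup>+k. A (\<phi> (y, k)) \<partial>K) + W 1 y * (\<integral>\<^sup>+k. B (\<phi> (y, k)) \<partial>K)"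
        by (simp add: nn_integral_add nn_integral_cmult)
      finally show ?thesis .
    qed
    then have "(\<integral>\<^sup>+y. F (W 0 y) (W 1 y) \<partial>M) \<le>
        (\<integral>\<^sup>+y. W 0 y * (\<integral>\<^sup>+k. A (\<phi> (y, k)) \<partial>K) + W 1 y * (\<integral>\<^sup>+k. B (\<phi> (y, k)) \<partial>K) \<partial>M)"
      by (rule nn_integral_mono)
    also have "\<dots> = (\<integral>\<^sup>+z. W' 0 z * ennreal (A z) \<partial>M') + (\<integral>\<^sup>+z. W' 1 z * ennreal (B z) \<partial>M')"
      by (simp add: nn_integral_add nn_integral_degraded)
    also have "\<dots> = (\<integral>\<^sup>+z. W' 0 z * ennreal (A z) + W' 1 z * ennreal (B z) \<partial>M')"
      by (simp add: nn_integral_add)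
    \<comment> \<open>On the degraded side each coefficient pair meets the very densities it was
      built from, so \<open>tight\<close> applies; the error integrates to \<epsilon> times the
      total mass \<open>C\<close>.\<close>
    also have "\<dots> \<le> (\<integral>\<^sup>+z. ennreal (F (W' 0 z) (W' 1 z)) + ennreal \<epsilon> * (ennreal (W' 0 z) + ennreal (W' 1 z)) \<partial>M')"
    proof (rule nn_integral_mono)
      fix z
      have "W' 0 z * A z + W' 1 z * B z \<le> F (W' 0 z) (W' 1 z) + \<epsilon> * (W' 0 z + W' 1 z)"
        using tight[OF \<epsilon> nonneg(2) nonneg(2), of 0 z 1 z] by (simp add: A_def B_def mult.commute)
      then show "W' 0 z * ennreal (A z) + W' 1 z * ennreal (B z) \<le>
          ennreal (F (W' 0 z) (W' 1 z)) + ennreal \<epsilon> * (ennreal (W' 0 z) + ennreal (W' 1 z))"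
        using AB nonneg \<epsilon> F_nonneg
        by (simp add: ennreal_mult[symmetric] ennreal_plus[symmetric] del: ennreal_plus)
    qed
    also have "\<dots> = (\<integral>\<^sup>+z. F (W' 0 z) (W' 1 z) \<partial>M') + ennreal \<epsilon> * C"
      by (simp add: nn_integral_add nn_integral_cmult C_def nn_integral_degraded_total)
    finally show ?thesis .
  qed
  show ?thesis
  proof (rule ennreal_le_epsilon)
    fix e :: real assume "0 < e"
    define c where "c = enn2real C"
    have c: "C = ennreal c" "0 \<le> c" using C by (simp_all add: c_def)
    \<comment> \<open>The summand 1 keeps the denominator positive when \<open>c\<close> is
      0.\<close>
    have "ennreal (e / (c + 1)) * C \<le> e"
      using \<open>0 < e\<close> c by (simp add: ennreal_mult[symmetric] field_simps)
    then show "(\<integral>\<^sup>+y. F (W 0 y) (W 1 y) \<partial>M) \<le> (\<integral>\<^sup>+z. F (W' 0 z) (W' 1 z) \<partial>M') + ennreal e"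
      using approx[of "e / (c + 1)"] \<open>0 < e\<close> c(2) by (meson add_left_mono add_nonneg_pos divide_pos_pos order_trans zero_less_one)
  qed
qed

text \<open>The Bochner integral of a non-integrable function is 0, so the inequality transfers only
  if the right-hand side is finite. The bound by \<open>p + q\<close> and the finite total masses
  provide this.\<close>

lemma integral_le_if_nn_integral_le:
  fixes F :: "real \<Rightarrow> real \<Rightarrow> real"
  assumes [measurable]: "case_prod F \<in> borel_measurable borel"
    and F_nonneg: "\<And>p q. 0 \<le> p \<Longrightarrow> 0 \<le> q \<Longrightarrow> 0 \<le> F p q"
    and F_le: "\<And>p q. 0 \<le> p \<Longrightarrow> 0 \<le> q \<Longrightarrow> F p q \<le> p + q"
    and le: "(\<integral>\<^sup>+y. F (W 0 y) (W 1 y) \<partial>M) \<le> (\<integral>\<^sup>+z. F (W' 0 z) (W' 1 z) \<partial>M')"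
  shows "(LINT y|M. F (W 0 y) (W 1 y)) \<le> (LINT z|M'. F (W' 0 z) (W' 1 z))"
proof -
  have Fm [measurable]: "(\<lambda>y. F (f y) (g y)) \<in> borel_measurable N"
    if [measurable]: "f \<in> borel_measurable N" "g \<in> borel_measurable N" for f g and N :: "'q measure"
    using measurable_compose[of "\<lambda>y. (f y, g y)" N borel, OF _ assms(1)] by (simp add: borel_prod[symmetric])
  have "(\<integral>\<^sup>+z. F (W' 0 z) (W' 1 z) \<partial>M') \<le> (\<integral>\<^sup>+z. ennreal (W' 0 z) + ennreal (W' 1 z) \<partial>M')"
    using F_le nonneg by (intro nn_integral_mono) (simp add: ennreal_plus[symmetric] del: ennreal_plus)
  also have "\<dots> < \<infinity>"
    using nn_integral_W_finite by (simp add: nn_integral_add nn_integral_degraded_total)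
  finally show ?thesis
    using le F_nonneg nonneg by (simp add: integral_eq_nn_integral enn2real_mono)
qed

text \<open>The minimum is the smaller of two linear functions, with coefficients (1, 0) and (0, 1).
  It is attained, so the coefficients do not depend on \<epsilon>.\<close>

lemma error_probability_le: "error_probability M W \<le> error_probability M' W'"
proof -
  have "(LINT y|M. min (W 0 y) (W 1 y)) \<le> (LINT z|M'. min (W' 0 z) (W' 1 z))"
  proof (rule integral_le_if_nn_integral_le)
    show "(\<integral>\<^sup>+y. min (W 0 y) (W 1 y) \<partial>M) \<le> (\<integral>\<^sup>+z. min (W' 0 z) (W' 1 z) \<partial>M')"
      by (rule nn_integral_data_processing[where
            \<alpha> = "\<lambda>_ p q. if p < q then 1 else 0" and \<beta> = "\<lambda>_ p q. if p < q then 0 else 1"])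
        (auto simp: borel_prod[symmetric])
  qed (auto simp: borel_prod[symmetric])
  then show ?thesis by (simp add: error_probability_def)
qed

text \<open>The coefficients come from the weighted AM-GM inequality
  \<open>2 sqrt (p q) \<le> g p + q / g\<close>, with equality for \<open>g = sqrt (q / p)\<close>; where p or q vanishes,
  g is replaced by \<open>\<epsilon>\<close> or \<open>1 / \<epsilon>\<close>.\<close>

lemma bhattacharyya_le: "bhattacharyya M W \<le> bhattacharyya M' W'"
proof -
  define g where "g \<epsilon> p q =
    (if 0 < p \<and> 0 < q then sqrt q / sqrt p else if q \<le> 0 then \<epsilon> else 1 / \<epsilon>)" for \<epsilon> p q :: real
  have g_pos: "0 < g \<epsilon> p q" if "0 < \<epsilon>" for \<epsilon> p q using that by (simp add: g_def)
  have [measurable]: "(\<lambda>(p, q). g \<epsilon> p q) \<in> borel_measurable (borel \<Otimes>\<^sub>M borel)" for \<epsilon>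
    unfolding g_def by measurable
  have amgm: "sqrt (p * q) \<le> c / 2 * p + 1 / (2 * c) * q" if "0 \<le> p" "0 \<le> q" "0 < c" for p q c :: real
  proof -
    have "sqrt ((c * p) * (q / c)) \<le> (c * p + q / c) / 2"
      using that by (intro arith_geo_mean_sqrt) auto
    then show ?thesis using that by (simp add: field_simps)
  qed
  have tight: "g \<epsilon> p q / 2 * p + 1 / (2 * g \<epsilon> p q) * q \<le> sqrt (p * q) + \<epsilon> * (p + q)"
    if "0 < \<epsilon>" "0 \<le> p" "0 \<le> q" for \<epsilon> p q
  proof (cases "0 < p \<and> 0 < q")
    case True
    then have "sqrt q / sqrt p * p = sqrt (p * q)" "q / (sqrt q / sqrt p) = sqrt (p * q)"
      by (simp_all add: real_sqrt_mult real_div_sqrt field_simps)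
    then have "g \<epsilon> p q / 2 * p + 1 / (2 * g \<epsilon> p q) * q = sqrt (p * q)"
      using True by (simp add: g_def field_simps)
    then show ?thesis using that by simp
  next
    \<comment> \<open>Here the root is 0, but \<open>c / 2 * p + 1 / (2 * c) * q\<close> is positive
      for every \<open>c > 0\<close> unless both arguments vanish: the infimum is not attained. This
      is why \<epsilon> occurs; the chosen \<open>g\<close> leaves \<epsilon> / 2 times the nonzero
      argument.\<close>
    case False
    then have "p = 0 \<or> q = 0" using that by auto
    then show ?thesis using that by (auto simp: g_def)
  qed
  have "(LINT y|M. sqrt (W 0 y * W 1 y)) \<le> (LINT z|M'. sqrt (W' 0 z * W' 1 z))"
  proof (rule integral_le_if_nn_integral_le)
    show "sqrt (p * q) \<le> p + q" if "0 \<le> p" "0 \<le> q" for p q :: real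
      using amgm[OF that, of 1] that by simp
    show "(\<integral>\<^sup>+y. sqrt (W 0 y * W 1 y) \<partial>M) \<le> (\<integral>\<^sup>+z. sqrt (W' 0 z * W' 1 z) \<partial>M')"
      by (rule nn_integral_data_processing[where
            \<alpha> = "\<lambda>\<epsilon> p q. g \<epsilon> p q / 2" and \<beta> = "\<lambda>\<epsilon> p q. 1 / (2 * g \<epsilon> p q)"])
        (use g_pos tight in \<open>auto simp: borel_prod[symmetric] less_imp_le intro!: amgm[simplified]\<close>)
  qed (simp_all add: borel_prod[symmetric])
  then show ?thesis by (simp add: bhattacharyya_def)
qed


end

section \<open>Products of densities and of randomized outputs\<close>

text \<open>Identifies the output law of N independent uses of a channel, given by a product of
  densities, as a product measure. Both sides agree on boxes, where the integral factors.\<close>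

lemma (in product_sigma_finite) PiM_density:
  assumes J: "finite J" and f [measurable]: "\<And>j. j \<in> J \<Longrightarrow> f j \<in> borel_measurable (M j)"
    and fin: "\<And>j. sigma_finite_measure (density (M j) (f j))"
  shows "PiM J (\<lambda>j. density (M j) (f j)) = density (PiM J M) (\<lambda>y. \<Prod>j\<in>J. f j (y j))"
proof -
  interpret D: product_sigma_finite "\<lambda>j. density (M j) (f j)"
    by (simp add: product_sigma_finite_def fin)
  have "density (PiM J M) (\<lambda>y. \<Prod>j\<in>J. f j (y j)) = PiM J (\<lambda>j. density (M j) (f j))"
  proof (rule D.PiM_eqI[OF J])
    show "sets (density (PiM J M) (\<lambda>y. \<Prod>j\<in>J. f j (y j))) = sets (PiM J (\<lambda>j. density (M j) (f j)))"
      by (simp cong: sets_PiM_cong)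
    fix A assume A: "\<And>j. j \<in> J \<Longrightarrow> A j \<in> sets (density (M j) (f j))"
    then have [measurable]: "A j \<in> sets (M j)" if "j \<in> J" for j using that by simp
    have m: "PiE J A \<in> sets (PiM J M)" using J by (intro sets_PiM_I_finite) simp_all
    have "emeasure (density (PiM J M) (\<lambda>y. \<Prod>j\<in>J. f j (y j))) (PiE J A) =
        (\<integral>\<^sup>+y. (\<Prod>j\<in>J. f j (y j)) * indicator (PiE J A) y \<partial>PiM J M)"
      using J m by (intro emeasure_density) simp_all
    also have "\<dots> = (\<integral>\<^sup>+y. (\<Prod>j\<in>J. f j (y j) * indicator (A j) (y j)) \<partial>PiM J M)"
    proof (rule nn_integral_cong)
      fix y assume "y \<in> space (PiM J M)"
      then have "indicator (PiE J A) y = (\<Prod>j\<in>J. indicator (A j) (y j) :: ennreal)"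
        using J by (auto simp: space_PiM PiE_def indicator_def prod_zero_iff Pi_def extensional_def)
      then show "(\<Prod>j\<in>J. f j (y j)) * indicator (PiE J A) y = (\<Prod>j\<in>J. f j (y j) * indicator (A j) (y j))"
        by (simp add: prod.distrib)
    qed
    also have "\<dots> = (\<Prod>j\<in>J. \<integral>\<^sup>+y. f j y * indicator (A j) y \<partial>M j)"
      using J by (intro product_nn_integral_prod) simp_all
    also have "\<dots> = (\<Prod>j\<in>J. emeasure (density (M j) (f j)) (A j))"
      by (intro prod.cong refl) (simp add: emeasure_density)
    finally show "emeasure (density (PiM J M) (\<lambda>y. \<Prod>j\<in>J. f j (y j))) (PiE J A) =
        (\<Prod>j\<in>J. emeasure (density (M j) (f j)) (A j))" .
  qed
  then show ?thesis by simp
qed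

text \<open>Randomizing each coordinate with its own noise commutes with forming the product. The
  indicator of a box factors over the coordinates, so the noise can be integrated out coordinate by
  coordinate, and then the inputs.\<close>

lemma PiM_distr_pair:
  fixes P :: "'i \<Rightarrow> 'a measure" and K :: "'k measure" and M :: "'z measure"
  assumes J: "finite J" and P: "\<And>j. finite_measure (P j)" and K: "prob_space K"
    and \<phi> [measurable]: "\<And>j. j \<in> J \<Longrightarrow> \<phi> \<in> P j \<Otimes>\<^sub>M K \<rightarrow>\<^sub>M M"
  shows "PiM J (\<lambda>j. distr (P j \<Otimes>\<^sub>M K) M \<phi>) =
    distr (PiM J P \<Otimes>\<^sub>M PiM J (\<lambda>_. K)) (PiM J (\<lambda>_. M)) (\<lambda>(y, k). \<lambda>j\<in>J. \<phi> (y j, k j))"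
proof -
  interpret K: prob_space K by fact
  interpret P: product_sigma_finite P
    using P by (simp add: product_sigma_finite_def finite_measure_def)
  interpret KJ: product_sigma_finite "\<lambda>_::'i. K" ..
  interpret KJ': prob_space "PiM J (\<lambda>_. K)" by (rule prob_space_PiM) (rule K)
  have fin: "finite_measure (distr (P j \<Otimes>\<^sub>M K) M \<phi>)" if "j \<in> J" for j
  proof -
    interpret Pj: finite_measure "P j" by (rule P)
    interpret finite_measure "P j \<Otimes>\<^sub>M K" by (rule finite_measure_pair_measure) unfold_locales
    show ?thesis using that by (intro finite_measure_distr \<phi>)
  qed
  \<comment> \<open>\<open>product_sigma_finite\<close> asks for sigma-finiteness at every index,
    whereas \<phi> is known to be measurable only for indices in \<open>J\<close>. Outside
    \<open>J\<close> the zero measure on the empty space serves as a filler.\<close>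
  define D where "D j = (if j \<in> J then distr (P j \<Otimes>\<^sub>M K) M \<phi> else count_space {})" for j
  interpret D: product_sigma_finite D
    using fin by (auto simp: product_sigma_finite_def D_def finite_measure_def
        intro: sigma_finite_measure_count_space_finite)
  have D_eq: "PiM J (\<lambda>j. distr (P j \<Otimes>\<^sub>M K) M \<phi>) = PiM J D"
    by (rule PiM_cong) (simp_all add: D_def)
  let ?\<Phi> = "\<lambda>(y, k). \<lambda>j\<in>J. \<phi> (y j, k j)"
  have \<Phi>: "?\<Phi> \<in> PiM J P \<Otimes>\<^sub>M PiM J (\<lambda>_. K) \<rightarrow>\<^sub>M PiM J (\<lambda>_. M)"
    unfolding split_beta' by (rule measurable_restrict) measurable
  have "distr (PiM J P \<Otimes>\<^sub>M PiM J (\<lambda>_. K)) (PiM J (\<lambda>_. M)) ?\<Phi> = PiM J D"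
  proof (rule D.PiM_eqI[OF J])
    show "sets (distr (PiM J P \<Otimes>\<^sub>M PiM J (\<lambda>_. K)) (PiM J (\<lambda>_. M)) ?\<Phi>) = sets (PiM J D)"
      by (simp add: D_def cong: sets_PiM_cong)
    fix A assume "\<And>j. j \<in> J \<Longrightarrow> A j \<in> sets (D j)"
    then have [measurable]: "A j \<in> sets M" if "j \<in> J" for j using that by (simp add: D_def)
    have m [measurable]: "PiE J A \<in> sets (PiM J (\<lambda>_. M))" using J by (intro sets_PiM_I_finite) simp_all
    have "emeasure (distr (PiM J P \<Otimes>\<^sub>M PiM J (\<lambda>_. K)) (PiM J (\<lambda>_. M)) ?\<Phi>) (PiE J A) =
       (\<integral>\<^sup>+z. indicator (PiE J A) z \<partial>distr (PiM J P \<Otimes>\<^sub>M PiM J (\<lambda>_. K)) (PiM J (\<lambda>_. M)) ?\<Phi>)"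
      using m by (subst nn_integral_indicator) simp_all
    also have "\<dots> = (\<integral>\<^sup>+p. indicator (PiE J A) (?\<Phi> p) \<partial>(PiM J P \<Otimes>\<^sub>M PiM J (\<lambda>_. K)))"
      using m by (intro nn_integral_distr[OF \<Phi>]) simp
    also have "\<dots> = (\<integral>\<^sup>+y. \<integral>\<^sup>+k. indicator (PiE J A) (?\<Phi> (y, k)) \<partial>PiM J (\<lambda>_. K) \<partial>PiM J P)"
      by (rule KJ'.nn_integral_fst[symmetric], rule measurable_compose[OF \<Phi>]) (use m in simp)
    also have "\<dots> = (\<integral>\<^sup>+y. \<integral>\<^sup>+k. (\<Prod>j\<in>J. indicator (A j) (\<phi> (y j, k j))) \<partial>PiM J (\<lambda>_. K) \<partial>PiM J P)"
      using J by (intro nn_integral_cong) (auto simp: indicator_def prod_zero_iff PiE_def Pi_def)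
    also have "\<dots> = (\<integral>\<^sup>+y. (\<Prod>j\<in>J. \<integral>\<^sup>+k. indicator (A j) (\<phi> (y j, k)) \<partial>K) \<partial>PiM J P)"
    proof (rule nn_integral_cong)
      fix y assume "y \<in> space (PiM J P)"
      then have y [measurable]: "y j \<in> space (P j)" if "j \<in> J" for j using that by (auto simp: space_PiM)
      show "(\<integral>\<^sup>+k. (\<Prod>j\<in>J. indicator (A j) (\<phi> (y j, k j))) \<partial>PiM J (\<lambda>_. K)) =
          (\<Prod>j\<in>J. \<integral>\<^sup>+k. indicator (A j) (\<phi> (y j, k)) \<partial>K)"
        using J by (intro KJ.product_nn_integral_prod[where f = "\<lambda>j k. indicator (A j) (\<phi> (y j, k))"]) simp_all
    qed
    also have "\<dots> = (\<Prod>j\<in>J. \<integral>\<^sup>+y. \<integral>\<^sup>+k. indicator (A j) (\<phi> (y, k)) \<partial>K \<partial>P j)"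
      using J by (intro P.product_nn_integral_prod) simp_all
    also have "\<dots> = (\<Prod>j\<in>J. emeasure (D j) (A j))"
    proof (rule prod.cong[OF refl])
      fix j assume j [measurable]: "j \<in> J"
      have "(\<integral>\<^sup>+y. \<integral>\<^sup>+k. indicator (A j) (\<phi> (y, k)) \<partial>K \<partial>P j) =
          (\<integral>\<^sup>+p. indicator (A j) (\<phi> p) \<partial>(P j \<Otimes>\<^sub>M K))"
        by (rule K.nn_integral_fst) simp
      also have "\<dots> = (\<integral>\<^sup>+z. indicator (A j) z \<partial>D j)"
        unfolding D_def using j by (simp add: nn_integral_distr del: nn_integral_indicator)
      finally show "(\<integral>\<^sup>+y. \<integral>\<^sup>+k. indicator (A j) (\<phi> (y, k)) \<partial>K \<partial>P j) = emeasure (D j) (A j)"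
        using j by (simp add: D_def)
    qed
    finally show "emeasure (distr (PiM J P \<Otimes>\<^sub>M PiM J (\<lambda>_. K)) (PiM J (\<lambda>_. M)) ?\<Phi>) (PiE J A) =
      (\<Prod>j\<in>J. emeasure (D j) (A j))" .
  qed
  then show ?thesis by (simp add: D_eq)
qed

section \<open>Polar subchannels\<close>

lemma measurable_pair_count_space:
  assumes U: "countable U" and f: "\<And>u. u \<in> U \<Longrightarrow> (\<lambda>y. f (y, u)) \<in> A \<rightarrow>\<^sub>M B"
  shows "f \<in> A \<Otimes>\<^sub>M count_space U \<rightarrow>\<^sub>M B"
proof -
  have "(\<lambda>p. f (fst p, snd p)) \<in> A \<Otimes>\<^sub>M count_space U \<rightarrow>\<^sub>M B"
    by (rule measurable_compose_countable'[where f = "\<lambda>u p. f (fst p, u)" and g = snd and I = U])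
      (auto intro: measurable_compose[OF measurable_fst f] U)
  then show ?thesis by simp
qed

lemma measurable_subchannel:
  assumes [measurable]: "\<And>b. W b \<in> borel_measurable M"
  shows "subchannel m i W b \<in> borel_measurable (subchannel_output m i M)"
  unfolding subchannel_output_def
proof (rule measurable_pair_count_space)
  show "countable ({..<i} \<rightarrow>\<^sub>E {0, 1 :: bit})" by (intro countable_PiE) auto
  show "(\<lambda>y. subchannel m i W b (y, u)) \<in> borel_measurable (\<Pi>\<^sub>M j\<in>{..<2 ^ m}. M)" for u
    unfolding subchannel_def prod.case by measurable
qed

text \<open>Presents the subchannel as a finite mixture: once past bits \<open>u\<close> and future
  bits \<open>v\<close> are fixed, the codeword is fixed and the outputs follow a product measure.
  Degradation can then be checked separately for each codeword.\<close>

lemma nn_integral_subchannel: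
  fixes h :: "(nat \<Rightarrow> 'y) \<times> (nat \<Rightarrow> bit) \<Rightarrow> ennreal"
  assumes M: "sigma_finite_measure M"
    and W [measurable]: "\<And>b. W b \<in> borel_measurable M" and nonneg: "\<And>b y. 0 \<le> W b y"
    and fin: "\<And>b. finite_measure (density M (W b))"
    and h [measurable]: "h \<in> borel_measurable (subchannel_output m i M)"
  shows "(\<integral>\<^sup>+p. subchannel m i W b p * h p \<partial>subchannel_output m i M) =
    (\<Sum>u\<in>{..<i} \<rightarrow>\<^sub>E {0, 1}. ennreal (1 / 2 ^ (2 ^ m - 1)) * (\<Sum>v\<in>{i + 1..<2 ^ m} \<rightarrow>\<^sub>E {0, 1}.
      \<integral>\<^sup>+y. h (y, u) \<partial>PiM {..<2 ^ m} (\<lambda>j. density M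
        (W (polar_encode m (\<lambda>k. if k < i then u k else if k = i then b else v k) j)))))"
proof -
  define A where "A = (\<Pi>\<^sub>M j\<in>{..<(2::nat) ^ m}. M)"
  define U where "U = {..<i} \<rightarrow>\<^sub>E {0, 1 :: bit}"
  define V where "V = {i + 1..<2 ^ m} \<rightarrow>\<^sub>E {0, 1 :: bit}"
  define x where "x u v = polar_encode m (\<lambda>k. if k < i then u k else if k = i then b else v k)" for u v
  have out: "subchannel_output m i M = A \<Otimes>\<^sub>M count_space U"
    by (simp add: subchannel_output_def A_def U_def)
  have finU: "finite U" and finV: "finite V" by (auto simp: U_def V_def intro!: finite_PiE)
  interpret Mp: product_sigma_finite "\<lambda>_::nat. M" by (simp add: product_sigma_finite_def M)
  interpret A: sigma_finite_measure A unfolding A_def by (rule Mp.sigma_finite) simp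
  interpret U: sigma_finite_measure "count_space U" by (rule sigma_finite_measure_count_space_finite[OF finU])
  interpret AU: pair_sigma_finite A "count_space U" ..
  have [measurable]: "subchannel m i W b \<in> borel_measurable (A \<Otimes>\<^sub>M count_space U)"
    using measurable_subchannel[of W M m i b] by (simp add: out)
  have [measurable]: "h \<in> borel_measurable (A \<Otimes>\<^sub>M count_space U)" using h by (simp add: out)
  have inner: "(\<integral>\<^sup>+y. subchannel m i W b (y, u) * h (y, u) \<partial>A) =
      ennreal (1 / 2 ^ (2 ^ m - 1)) *
      (\<Sum>v\<in>V. \<integral>\<^sup>+y. h (y, u) \<partial>PiM {..<2 ^ m} (\<lambda>j. density M (W (x u v j))))"
    if u [measurable]: "u \<in> U" for u
  proof -
    have hu [measurable]: "(\<lambda>y. h (y, u)) \<in> borel_measurable A"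
      by (rule measurable_compose[OF measurable_Pair2'[of u "count_space U"]]) (use u in simp_all)
    have [measurable]: "(\<lambda>y. \<Prod>j<2 ^ m. ennreal (W (x u v j) (y j))) \<in> borel_measurable A" for v
      unfolding A_def by measurable
    have "(\<integral>\<^sup>+y. subchannel m i W b (y, u) * h (y, u) \<partial>A) =
      (\<integral>\<^sup>+y. ennreal (1 / 2 ^ (2 ^ m - 1)) *
        (\<Sum>v\<in>V. (\<Prod>j<2 ^ m. ennreal (W (x u v j) (y j))) * h (y, u)) \<partial>A)"
    proof (rule nn_integral_cong)
      fix y
      have "ennreal (subchannel m i W b (y, u)) =
          ennreal (1 / 2 ^ (2 ^ m - 1)) * (\<Sum>v\<in>V. \<Prod>j<2 ^ m. ennreal (W (x u v j) (y j)))"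
        unfolding subchannel_def prod.case V_def[symmetric] x_def[symmetric]
        by (subst ennreal_mult) (simp_all add: sum_nonneg prod_nonneg nonneg prod_ennreal)
      then show "ennreal (subchannel m i W b (y, u)) * h (y, u) = ennreal (1 / 2 ^ (2 ^ m - 1)) *
          (\<Sum>v\<in>V. (\<Prod>j<2 ^ m. ennreal (W (x u v j) (y j))) * h (y, u))"
        by (simp add: sum_distrib_right mult.assoc)
    qed
    also have "\<dots> = ennreal (1 / 2 ^ (2 ^ m - 1)) *
        (\<Sum>v\<in>V. \<integral>\<^sup>+y. (\<Prod>j<2 ^ m. ennreal (W (x u v j) (y j))) * h (y, u) \<partial>A)"
      by (simp add: nn_integral_cmult nn_integral_sum)
    also have "(\<Sum>v\<in>V. \<integral>\<^sup>+y. (\<Prod>j<2 ^ m. ennreal (W (x u v j) (y j))) * h (y, u) \<partial>A) =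
        (\<Sum>v\<in>V. \<integral>\<^sup>+y. h (y, u) \<partial>PiM {..<2 ^ m} (\<lambda>j. density M (W (x u v j))))"
    proof (rule sum.cong[OF refl])
      fix v
      have "PiM {..<2 ^ m} (\<lambda>j. density M (W (x u v j))) =
          density A (\<lambda>y. \<Prod>j<2 ^ m. ennreal (W (x u v j) (y j)))"
        unfolding A_def using fin
        by (intro Mp.PiM_density) (auto simp: finite_measure_def)
      then show "(\<integral>\<^sup>+y. (\<Prod>j<2 ^ m. ennreal (W (x u v j) (y j))) * h (y, u) \<partial>A) =
          (\<integral>\<^sup>+y. h (y, u) \<partial>PiM {..<2 ^ m} (\<lambda>j. density M (W (x u v j))))"
        by (simp add: nn_integral_density)
    qed
    finally show ?thesis .
  qed
  have "(\<integral>\<^sup>+p. subchannel m i W b p * h p \<partial>subchannel_output m i M) =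
    (\<integral>\<^sup>+u. \<integral>\<^sup>+y. subchannel m i W b (y, u) * h (y, u) \<partial>A \<partial>count_space U)"
    unfolding out by (rule AU.nn_integral_snd[symmetric]) measurable
  also have "\<dots> = (\<Sum>u\<in>U. \<integral>\<^sup>+y. subchannel m i W b (y, u) * h (y, u) \<partial>A)"
    by (rule nn_integral_count_space_finite[OF finU])
  finally show ?thesis
    by (simp add: inner x_def U_def V_def)
qed

context degraded_channel
begin

text \<open>Every output is degraded with its own copy of the noise and the past bits are passed on
  unchanged. The codewords in the mixture depend on the bits alone, so they are the same for both
  channels.\<close>

theorem degraded_subchannel:
  "degraded_channel (subchannel_output m i M) (subchannel m i W)
     (subchannel_output m i M') (subchannel m i W') (\<Pi>\<^sub>M j\<in>{..<2 ^ m}. K)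
     (\<lambda>((y, u), k). (\<lambda>j\<in>{..<2 ^ m}. \<phi> (y j, k j), u))"
proof -
  let ?J = "{..<(2::nat) ^ m}" and ?U = "{..<i} \<rightarrow>\<^sub>E {0, 1 :: bit}"
  let ?V = "{i + 1..<2 ^ m} \<rightarrow>\<^sub>E {0, 1 :: bit}"
  let ?\<Phi> = "\<lambda>((y, u), k). (\<lambda>j\<in>?J. \<phi> (y j, k j), u)"
  let ?Out = "subchannel_output m i M" and ?Out' = "subchannel_output m i M'"
  let ?KJ = "\<Pi>\<^sub>M j\<in>?J. K"
  interpret K: prob_space K by (rule noise)
  interpret KJ: prob_space ?KJ by (rule prob_space_PiM) (rule noise)
  have finU: "finite ?U" and finV: "finite ?V" by (auto intro!: finite_PiE)
  have finite': "finite_measure (density M' (W' b))" for b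
  proof -
    interpret finite_measure "density M (W b)" by (rule finite)
    interpret finite_measure "density M (W b) \<Otimes>\<^sub>M K"
      by (rule finite_measure_pair_measure) unfold_locales
    show ?thesis unfolding pushforward by (rule finite_measure_distr) simp
  qed
  have sf: "sigma_finite_measure (subchannel_output m i N)" if N: "sigma_finite_measure N" for N :: "'q measure"
  proof -
    interpret product_sigma_finite "\<lambda>_::nat. N" by (simp add: product_sigma_finite_def N)
    interpret pair_sigma_finite "\<Pi>\<^sub>M j\<in>?J. N" "count_space ?U"
      using finU by (intro pair_sigma_finite.intro sigma_finite sigma_finite_measure_count_space_finite) simp
    show ?thesis unfolding subchannel_output_def by unfold_locales
  qed
  have \<Phi> [measurable]: "?\<Phi> \<in> ?Out \<Otimes>\<^sub>M ?KJ \<rightarrow>\<^sub>M ?Out'"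
    unfolding subchannel_output_def split_beta' by measurable
  have W_m [measurable]: "subchannel m i W b \<in> borel_measurable ?Out" for b
    by (rule measurable_subchannel) simp
  have W'_m [measurable]: "subchannel m i W' b \<in> borel_measurable ?Out'" for b
    by (rule measurable_subchannel) simp
  have nonneg_sub: "0 \<le> subchannel m i W b p" "0 \<le> subchannel m i W' b p'" for b p p'
    using nonneg by (auto simp: subchannel_def split_beta' intro!: divide_nonneg_nonneg sum_nonneg prod_nonneg)
  have finite_sub: "finite_measure (density ?Out (subchannel m i W b))" for b
  proof (rule finite_measureI)
    interpret P: product_sigma_finite "\<lambda>j. density M (W (x j))" for x :: "nat \<Rightarrow> bit"
      using finite by (simp add: product_sigma_finite_def finite_measure_def)
    have fin: "(\<integral>\<^sup>+y. 1 \<partial>PiM ?J (\<lambda>j. density M (W (x j)))) \<noteq> \<infinity>" for x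
    proof -
      \<comment> \<open>The constant 1 is written as a product so that the integral splits into the
        finite masses of the single channels.\<close>
      have "(\<integral>\<^sup>+y. (\<Prod>j\<in>?J. 1) \<partial>PiM ?J (\<lambda>j. density M (W (x j)))) =
          (\<Prod>j\<in>?J. \<integral>\<^sup>+y. 1 \<partial>density M (W (x j)))"
        by (rule P.product_nn_integral_prod) simp_all
      also have "\<dots> \<noteq> \<infinity>"
        using finite_measure.finite_emeasure_space[OF finite] by (simp add: ennreal_prod_eq_top)
      finally show ?thesis by simp
    qed
    have "emeasure (density ?Out (subchannel m i W b)) (space ?Out) =
        (\<integral>\<^sup>+p. ennreal (subchannel m i W b p) * 1 \<partial>?Out)"
      by (simp add: emeasure_density cong: nn_integral_cong)
    also have "\<dots> \<noteq> \<infinity>"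
      using fin finU finV
      by (subst nn_integral_subchannel[OF sigma_finite(1) measurable_W nonneg(1) finite])
        (simp_all add: ennreal_mult_eq_top_iff)
    finally show "emeasure (density ?Out (subchannel m i W b)) (space (density ?Out (subchannel m i W b))) \<noteq> \<infinity>"
      by simp
  qed
  have push: "density ?Out' (subchannel m i W' b) = distr (density ?Out (subchannel m i W b) \<Otimes>\<^sub>M ?KJ) ?Out' ?\<Phi>" for b
  proof (rule measure_eqI)
    fix X assume "X \<in> sets (density ?Out' (subchannel m i W' b))"
    then have X [measurable]: "X \<in> sets ?Out'" by simp
    let ?x = "\<lambda>u v. polar_encode m (\<lambda>k. if k < i then u k else if k = i then b else v k)"
    \<comment> \<open>The probability, given the better output \<open>p\<close>, that the degraded
      output falls into \<open>X\<close>.\<close>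
    define H where "H p = (\<integral>\<^sup>+k. indicator X (?\<Phi> (p, k)) \<partial>?KJ)" for p
    have [measurable]: "H \<in> borel_measurable ?Out" unfolding H_def by measurable
    have eq: "(\<integral>\<^sup>+y'. indicator X (y', u) \<partial>PiM ?J (\<lambda>j. density M' (W' (x j)))) =
        (\<integral>\<^sup>+y. H (y, u) \<partial>PiM ?J (\<lambda>j. density M (W (x j))))"
      if u: "u \<in> ?U" for u and x :: "nat \<Rightarrow> bit"
    proof -
      let ?P = "PiM ?J (\<lambda>j. density M (W (x j)))" and ?\<Psi> = "\<lambda>(y, k). \<lambda>j\<in>?J. \<phi> (y j, k j)"
      have [measurable]: "(\<lambda>y'. indicator X (y', u)) \<in> borel_measurable (PiM ?J (\<lambda>_. M'))"
        by (rule measurable_compose[OF measurable_Pair2'[of u "count_space ?U"]])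
          (use u X in \<open>simp_all add: subchannel_output_def\<close>)
      have [measurable]: "?\<Psi> \<in> ?P \<Otimes>\<^sub>M ?KJ \<rightarrow>\<^sub>M PiM ?J (\<lambda>_. M')"
        unfolding split_beta' by (rule measurable_restrict) measurable
      have "(\<integral>\<^sup>+y'. indicator X (y', u) \<partial>PiM ?J (\<lambda>j. density M' (W' (x j)))) =
          (\<integral>\<^sup>+y'. indicator X (y', u) \<partial>distr (?P \<Otimes>\<^sub>M ?KJ) (PiM ?J (\<lambda>_. M')) ?\<Psi>)"
        unfolding pushforward by (subst PiM_distr_pair) (simp_all add: finite noise)
      also have "\<dots> = (\<integral>\<^sup>+q. indicator X (?\<Psi> q, u) \<partial>(?P \<Otimes>\<^sub>M ?KJ))"
        by (rule nn_integral_distr) simp_all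
      also have "\<dots> = (\<integral>\<^sup>+y. \<integral>\<^sup>+k. indicator X (?\<Psi> (y, k), u) \<partial>?KJ \<partial>?P)"
        by (rule KJ.nn_integral_fst[symmetric]) measurable
      finally show ?thesis by (simp add: H_def)
    qed
    have "emeasure (density ?Out' (subchannel m i W' b)) X =
        (\<integral>\<^sup>+p. ennreal (subchannel m i W' b p) * indicator X p \<partial>?Out')"
      by (simp add: emeasure_density)
    \<comment> \<open>Both sides expand into the same double sum over past and future bits, and
      \<open>eq\<close> matches the summands, with the codeword in place of
      \<open>x\<close>.\<close>
    also have "\<dots> = (\<integral>\<^sup>+p. subchannel m i W b p * H p \<partial>?Out)"
      by (simp add: nn_integral_subchannel sigma_finite nonneg finite finite' eq)
    also have "\<dots> = (\<integral>\<^sup>+p. H p \<partial>density ?Out (subchannel m i W b))"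
      by (simp add: nn_integral_density)
    also have "\<dots> = (\<integral>\<^sup>+q. indicator X (?\<Phi> q) \<partial>(density ?Out (subchannel m i W b) \<Otimes>\<^sub>M ?KJ))"
      unfolding H_def by (rule KJ.nn_integral_fst) measurable
    also have "\<dots> = (\<integral>\<^sup>+p. indicator X p \<partial>distr (density ?Out (subchannel m i W b) \<Otimes>\<^sub>M ?KJ) ?Out' ?\<Phi>)"
      by (rule nn_integral_distr[symmetric]) simp_all
    also have "\<dots> = emeasure (distr (density ?Out (subchannel m i W b) \<Otimes>\<^sub>M ?KJ) ?Out' ?\<Phi>) X"
      by simp
    finally show "emeasure (density ?Out' (subchannel m i W' b)) X =
        emeasure (distr (density ?Out (subchannel m i W b) \<Otimes>\<^sub>M ?KJ) ?Out' ?\<Phi>) X" .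
  qed simp
  show ?thesis
    by (rule degraded_channel.intro)
      (simp_all add: sf sigma_finite KJ.prob_space_axioms nonneg_sub finite_sub push)
qed

end

section \<open>Monotonicity of codes and information sets\<close>

lemma polar_code_mono:
  assumes "I \<subseteq> J" "finite J"
  shows "polar_code m I \<subseteq> polar_code m J"
proof
  fix w assume "w \<in> polar_code m I"
  then obtain c where w: "w = (\<lambda>j\<in>{..<2 ^ m}. \<Sum>i\<in>I. c i * polar_matrix m i j)"
    by (auto simp: polar_code_def)
  have "(\<Sum>i\<in>I. c i * polar_matrix m i j) = (\<Sum>i\<in>J. (if i \<in> I then c i else 0) * polar_matrix m i j)" for j
    using assms by (intro sum.mono_neutral_cong_left) auto
  then show "w \<in> polar_code m J" by (auto simp: polar_code_def w)
qed

lemma info_set_mono: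
  assumes "degraded_channel M W M' W' K \<phi>"
  shows "info_set_Z m M' W' \<tau> \<subseteq> info_set_Z m M W \<tau>" "info_set_Pe m M' W' \<tau> \<subseteq> info_set_Pe m M W \<tau>"
  using degraded_channel.degraded_subchannel[OF assms]
  by (auto simp: info_set_Z_def info_set_Pe_def
      intro: le_less_trans[OF degraded_channel.bhattacharyya_le]
        le_less_trans[OF degraded_channel.error_probability_le])

section \<open>Gaussian noise\<close>

lemma nn_integral_lborel_translate:
  fixes f :: "'a::euclidean_space \<Rightarrow> ennreal"
  assumes [measurable]: "f \<in> borel_measurable borel"
  shows "(\<integral>\<^sup>+x. f (x + a) \<partial>lborel) = (\<integral>\<^sup>+x. f x \<partial>lborel)"
proof -
  have "(\<integral>\<^sup>+x. f x \<partial>lborel) = (\<integral>\<^sup>+x. f x \<partial>distr lborel borel ((+) a))"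
    by (simp add: lborel_distr_plus)
  then show ?thesis by (simp add: nn_integral_distr add.commute)
qed

lemma nn_integral_lborel_uminus:
  fixes f :: "'a::euclidean_space \<Rightarrow> ennreal"
  assumes [measurable]: "f \<in> borel_measurable borel"
  shows "(\<integral>\<^sup>+x. f (- x) \<partial>lborel) = (\<integral>\<^sup>+x. f x \<partial>lborel)"
proof -
  have "lborel = distr lborel borel (uminus :: 'a \<Rightarrow> 'a)"
    using lborel_affine[of "-1" "0::'a"] by (simp add: density_1)
  then have "(\<integral>\<^sup>+x. f x \<partial>lborel) = (\<integral>\<^sup>+x. f x \<partial>distr lborel borel (uminus :: 'a \<Rightarrow> 'a))"
    by simp
  then show ?thesis by (simp add: nn_integral_distr)
qed

lemma borel_measurable_orthogonal_transformation:
  fixes V :: "'a::euclidean_space \<Rightarrow> 'a"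
  assumes "orthogonal_transformation V"
  shows "V \<in> borel_measurable borel"
  using assms by (intro borel_measurable_continuous_onI linear_continuous_on)
    (simp add: linear_conv_bounded_linear[symmetric] orthogonal_transformation_linear)

text \<open>The image measure is translation invariant, hence by the uniqueness argument for Haar
  measure proportional to Lebesgue measure; the unit ball shows that the factor is 1.
  The library's \<open>measure_orthogonal_image\<close> needs a well-ordered index type.\<close>

lemma distr_lborel_orthogonal:
  fixes V :: "'a::euclidean_space \<Rightarrow> 'a"
  assumes V: "orthogonal_transformation V"
  shows "distr lborel borel V = lborel"
proof (rule measure_eqI)
  note [measurable] = borel_measurable_orthogonal_transformation[OF V]
  let ?\<mu> = "distr lborel borel V"
  let ?B = "ball 0 1 :: 'a set"
  have [measurable]: "?B \<in> sets borel" by simp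
  have lin: "V (x + y) = V x + V y" for x y
    using V by (simp add: orthogonal_transformation_linear linear_add)
  have translate: "(\<integral>\<^sup>+x. f (V x + a) \<partial>lborel) = (\<integral>\<^sup>+x. f (V x) \<partial>lborel)"
    if [measurable]: "f \<in> borel_measurable borel" for f :: "'a \<Rightarrow> ennreal" and a
  proof -
    obtain b where b: "V b = a"
      using orthogonal_transformation_surj[OF V] by (metis surjD)
    show ?thesis
      using nn_integral_lborel_translate[of "\<lambda>x. f (V x)" b] by (simp add: lin b)
  qed
  fix X assume "X \<in> sets ?\<mu>"
  then have [measurable]: "X \<in> sets borel" by simp
  have inner: "(\<integral>\<^sup>+y. c * indicator ?B y \<partial>lborel) = c * emeasure lborel ?B" for c
    by (rule nn_integral_cmult_indicator) simp
  have "emeasure ?\<mu> X = (\<integral>\<^sup>+x. indicator X x \<partial>?\<mu>)"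
    by simp
  also have "\<dots> = (\<integral>\<^sup>+x. indicator X (V x) \<partial>lborel)"
    by (rule nn_integral_distr) simp_all
  \<comment> \<open>Uniqueness of Haar measure: the product of the mass of \<open>X\<close> under
    one measure and the mass of the ball under the other is a double integral, which the shifts
    below rewrite with the roles of the measures exchanged.\<close>
  finally have "emeasure ?\<mu> X * emeasure lborel ?B =
      (\<integral>\<^sup>+x. \<integral>\<^sup>+y. indicator X (V x) * indicator ?B y \<partial>lborel \<partial>lborel)"
    by (simp add: inner nn_integral_multc)
  also have "\<dots> = (\<integral>\<^sup>+x. \<integral>\<^sup>+y. indicator X (V x) * indicator ?B (y + V x) \<partial>lborel \<partial>lborel)"
  proof (rule nn_integral_cong)
    fix x
    have "(\<integral>\<^sup>+y. c * indicator ?B (y + V x) \<partial>lborel) = (\<integral>\<^sup>+y. c * indicator ?B y \<partial>lborel)" for c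
      by (rule nn_integral_lborel_translate) measurable
    then show "(\<integral>\<^sup>+y. indicator X (V x) * indicator ?B y \<partial>lborel) =
        (\<integral>\<^sup>+y. indicator X (V x) * indicator ?B (y + V x) \<partial>lborel)" ..
  qed
  also have "\<dots> = (\<integral>\<^sup>+y. \<integral>\<^sup>+x. indicator X (V x) * indicator ?B (y + V x) \<partial>lborel \<partial>lborel)"
    by (rule lborel_pair.Fubini'[symmetric]) measurable
  \<comment> \<open>For fixed \<open>y\<close> the inner integral is one over the image measure,
    whose translation invariance moves the shift from the ball to \<open>X\<close>.\<close>
  also have "\<dots> = (\<integral>\<^sup>+y. \<integral>\<^sup>+x. indicator X (V x - y) * indicator ?B (V x) \<partial>lborel \<partial>lborel)"
  proof (rule nn_integral_cong)
    fix y
    show "(\<integral>\<^sup>+x. indicator X (V x) * indicator ?B (y + V x) \<partial>lborel) =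
        (\<integral>\<^sup>+x. indicator X (V x - y) * indicator ?B (V x) \<partial>lborel)"
      using translate[of "\<lambda>z. indicator X (z - y) * indicator ?B z" y] by (simp add: add.commute)
  qed
  also have "\<dots> = (\<integral>\<^sup>+x. \<integral>\<^sup>+y. indicator X (V x - y) * indicator ?B (V x) \<partial>lborel \<partial>lborel)"
    by (rule lborel_pair.Fubini') measurable
  also have "\<dots> = (\<integral>\<^sup>+x. emeasure lborel X * indicator ?B (V x) \<partial>lborel)"
  proof (rule nn_integral_cong)
    fix x
    have "(\<integral>\<^sup>+y. indicator X (V x - y) \<partial>lborel) = (\<integral>\<^sup>+y. indicator X (y + V x) \<partial>lborel)"
      using nn_integral_lborel_uminus[of "\<lambda>y. indicator X (y + V x)"] by (simp add: add.commute)
    also have "\<dots> = emeasure lborel X"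
      by (subst nn_integral_lborel_translate) simp_all
    finally show "(\<integral>\<^sup>+y. indicator X (V x - y) * indicator ?B (V x) \<partial>lborel) =
        emeasure lborel X * indicator ?B (V x)"
      by (simp add: nn_integral_multc)
  qed
  \<comment> \<open>The ball is invariant under \<open>V\<close>, which preserves norms; this fixes
    the factor of proportionality as 1.\<close>
  also have "\<dots> = emeasure lborel X * emeasure lborel ?B"
    by (simp add: nn_integral_cmult indicator_def orthogonal_transformation_norm[OF V])
      (simp add: nn_integral_indicator[symmetric] indicator_def del: nn_integral_indicator)
  finally have "emeasure ?\<mu> X * emeasure lborel ?B = emeasure lborel X * emeasure lborel ?B" .
  moreover have "emeasure lborel ?B \<noteq> 0" "emeasure lborel ?B \<noteq> \<infinity>"
    using content_ball_pos[of 1 "0::'a"] emeasure_lborel_ball_finite[of "0::'a" 1]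
    by (auto simp: measure_def zero_less_measure_iff top.not_eq_extremum[symmetric])
  ultimately show "emeasure ?\<mu> X = emeasure lborel X"
    by (metis ennreal_mult_cancel_left mult.commute infinity_ennreal_def)
qed simp

text \<open>The density depends on \<open>e\<close> only through its norm; this is the source of the
  rotation invariance of the noise.\<close>

lemma prod_normal_density:
  fixes e :: "real^'n"
  shows "(\<Prod>i\<in>UNIV. normal_density 0 \<sigma> (e $ i)) =
    (1 / sqrt (2 * pi * \<sigma>\<^sup>2)) ^ CARD('n) * exp (- (norm e)\<^sup>2 / (2 * \<sigma>\<^sup>2))"
proof -
  have "(\<Prod>i\<in>UNIV. normal_density 0 \<sigma> (e $ i)) =
      (1 / sqrt (2 * pi * \<sigma>\<^sup>2)) ^ CARD('n) * exp (\<Sum>i\<in>UNIV. - (e $ i)\<^sup>2 / (2 * \<sigma>\<^sup>2))"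
    unfolding normal_density_def prod.distrib by (simp add: exp_sum)
  also have "(\<Sum>i\<in>UNIV. - (e $ i)\<^sup>2 / (2 * \<sigma>\<^sup>2)) = - (norm e)\<^sup>2 / (2 * \<sigma>\<^sup>2)"
    by (simp add: norm_vec_def L2_set_def sum_nonneg sum_negf sum_divide_distrib[symmetric])
  finally show ?thesis .
qed

lemma borel_measurable_prod_normal_density [measurable]:
  "(\<lambda>e::real^'n. \<Prod>i\<in>UNIV. normal_density 0 \<sigma> (e $ i)) \<in> borel_measurable borel"
  unfolding prod_normal_density by measurable

lemma space_gaussian_noise [simp]: "space (gaussian_noise \<sigma>) = UNIV"
  and sets_gaussian_noise [simp, measurable_cong]: "sets (gaussian_noise \<sigma>) = sets borel"
  by (simp_all add: gaussian_noise_def)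

lemma nn_integral_lborel_vec_prod:
  fixes f :: "'n::finite \<Rightarrow> real \<Rightarrow> ennreal"
  assumes [measurable]: "\<And>i. f i \<in> borel_measurable borel"
  shows "(\<integral>\<^sup>+x. (\<Prod>i\<in>UNIV. f i (x $ i)) \<partial>(lborel :: (real^'n) measure)) = (\<Prod>i\<in>UNIV. \<integral>\<^sup>+x. f i x \<partial>lborel)"
proof -
  \<comment> \<open>Reindexes the factors from coordinates to basis vectors by inverting
    \<open>i \<mapsto> axis i 1\<close>. Off the basis the value is arbitrary, but still one of the
    measurable \<open>f i\<close>.\<close>
  define g where "g b = f (THE i. b = axis i (1::real))" for b :: "real^'n"
  have g: "g (axis i 1) = f i" for i by (simp add: g_def axis_eq_axis)
  have Basis: "Basis = range (\<lambda>i::'n. axis i (1::real))" by (auto simp: Basis_vec_def)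
  have inj: "inj (\<lambda>i::'n. axis i (1::real))" by (simp add: inj_on_def axis_eq_axis)
  have [measurable]: "g b \<in> borel_measurable borel" for b unfolding g_def by simp
  have "(\<integral>\<^sup>+x. (\<Prod>b\<in>Basis. g b (x \<bullet> b)) \<partial>lborel) = (\<Prod>b\<in>Basis. \<integral>\<^sup>+x. g b x \<partial>lborel)"
    by (rule nn_integral_lborel_prod) simp_all
  then show ?thesis unfolding Basis prod.reindex[OF inj] by (simp add: g inner_axis)
qed

lemma prob_space_gaussian_noise:
  assumes "0 < \<sigma>" shows "prob_space (gaussian_noise \<sigma> :: (real^'n) measure)"
proof
  have "emeasure (gaussian_noise \<sigma> :: (real^'n) measure) UNIV =
      (\<integral>\<^sup>+x. (\<Prod>i\<in>UNIV. ennreal (normal_density 0 \<sigma> (x $ i))) \<partial>(lborel :: (real^'n) measure))"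
    by (simp add: gaussian_noise_def emeasure_density prod_ennreal)
  also have "\<dots> = 1"
    using assms by (subst nn_integral_lborel_vec_prod)
      (simp_all add: nn_integral_eq_integral integral_normal_density integrable_normal_density)
  finally show "emeasure (gaussian_noise \<sigma>) (space (gaussian_noise \<sigma> :: (real^'n) measure)) = 1" by simp
qed

lemma distr_gaussian_noise_orthogonal:
  fixes V :: "real^'n \<Rightarrow> real^'n"
  assumes V: "orthogonal_transformation V"
  shows "distr (gaussian_noise \<sigma>) borel V = gaussian_noise \<sigma>"
proof -
  note [measurable] = borel_measurable_orthogonal_transformation[OF V]
  have "gaussian_noise \<sigma> = density (distr lborel borel V) (\<lambda>e. ennreal (\<Prod>i\<in>UNIV. normal_density 0 \<sigma> (e $ i)))"
    by (simp add: gaussian_noise_def distr_lborel_orthogonal[OF V])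
  also have "\<dots> = distr (density lborel (\<lambda>e. ennreal (\<Prod>i\<in>UNIV. normal_density 0 \<sigma> (V e $ i)))) borel V"
    by (rule density_distr) simp_all
  also have "(\<lambda>e. ennreal (\<Prod>i\<in>UNIV. normal_density 0 \<sigma> (V e $ i))) = (\<lambda>e. ennreal (\<Prod>i\<in>UNIV. normal_density 0 \<sigma> (e $ i)))"
    by (simp add: prod_normal_density orthogonal_transformation_norm[OF V])
  finally show ?thesis by (simp add: gaussian_noise_def)
qed

lemma distr_gaussian_noise_scaleR:
  assumes c: "0 < c" and \<sigma>: "0 < \<sigma>"
  shows "distr (gaussian_noise \<sigma>) borel (\<lambda>x::real^'n. c *\<^sub>R x) = gaussian_noise (c * \<sigma>)"
proof -
  let ?g = "\<lambda>\<sigma> e::real^'n. \<Prod>i\<in>UNIV. normal_density 0 \<sigma> (e $ i)"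
  have lb: "lborel = density (distr lborel borel (\<lambda>x::real^'n. c *\<^sub>R x)) (\<lambda>_. c ^ CARD('n))"
    using lborel_affine[of c "0::real^'n"] c by simp
  have "gaussian_noise (c * \<sigma>) = density (density (distr lborel borel (\<lambda>x::real^'n. c *\<^sub>R x)) (\<lambda>_. c ^ CARD('n))) (?g (c * \<sigma>))"
    unfolding gaussian_noise_def by (subst lb) simp
  also have "\<dots> = density (distr lborel borel (\<lambda>x::real^'n. c *\<^sub>R x)) (\<lambda>x. c ^ CARD('n) * ?g (c * \<sigma>) x)"
    by (subst density_density_eq) (use c in \<open>simp_all add: ennreal_mult' prod_nonneg\<close>)
  also have "\<dots> = distr (density lborel (\<lambda>x. c ^ CARD('n) * ?g (c * \<sigma>) (c *\<^sub>R x))) borel (\<lambda>x::real^'n. c *\<^sub>R x)"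
    by (rule density_distr) simp_all
  \<comment> \<open>The Jacobian is spread as one factor \<open>c\<close> per coordinate, where it
    cancels the \<open>1 / c\<close> in the normalizing constant of the wider normal
    density.\<close>
  also have "(\<lambda>x. c ^ CARD('n) * ?g (c * \<sigma>) (c *\<^sub>R x)) = ?g \<sigma>"
  proof
    fix x :: "real^'n"
    have "c ^ CARD('n) * ?g (c * \<sigma>) (c *\<^sub>R x) = (\<Prod>i\<in>UNIV. c * normal_density 0 (c * \<sigma>) (c * x $ i))"
      by (simp add: prod.distrib)
    also have "\<dots> = ?g \<sigma> x"
      using c \<sigma> by (intro prod.cong refl)
        (simp add: normal_density_def real_sqrt_mult power_mult_distrib field_simps)
    finally show "c ^ CARD('n) * ?g (c * \<sigma>) (c *\<^sub>R x) = ?g \<sigma> x" .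
  qed
  finally show ?thesis by (simp add: gaussian_noise_def)
qed

text \<open>The density of the sum is a convolution of product densities. It factors over the
  coordinates, and each factor is the one-dimensional Gaussian convolution.\<close>

lemma distr_gaussian_noise_add:
  assumes \<sigma>: "0 < \<sigma>" and \<tau>: "0 < \<tau>"
  shows "distr (gaussian_noise \<sigma> \<Otimes>\<^sub>M gaussian_noise \<tau>) borel (\<lambda>(x, y). x + y :: real^'n) =
    gaussian_noise (sqrt (\<sigma>\<^sup>2 + \<tau>\<^sup>2))"
proof (rule measure_eqI)
  let ?g = "\<lambda>\<sigma> e::real^'n. \<Prod>i\<in>UNIV. normal_density 0 \<sigma> (e $ i)"
  interpret G\<sigma>: prob_space "gaussian_noise \<sigma> :: (real^'n) measure" by (rule prob_space_gaussian_noise[OF \<sigma>])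
  interpret G\<tau>: prob_space "gaussian_noise \<tau> :: (real^'n) measure" by (rule prob_space_gaussian_noise[OF \<tau>])
  interpret G: pair_sigma_finite "gaussian_noise \<sigma> :: (real^'n) measure" "gaussian_noise \<tau> :: (real^'n) measure" ..
  have gm [measurable]: "(\<lambda>p. ?g s (f p)) \<in> borel_measurable N" if "f \<in> N \<rightarrow>\<^sub>M borel" for s f and N :: "'q measure"
    by (rule measurable_compose[OF that borel_measurable_prod_normal_density])
  fix X assume "X \<in> sets (distr (gaussian_noise \<sigma> \<Otimes>\<^sub>M gaussian_noise \<tau>) borel (\<lambda>(x, y). x + y :: real^'n))"
  then have X [measurable]: "X \<in> sets borel" by simp
  have "emeasure (distr (gaussian_noise \<sigma> \<Otimes>\<^sub>M gaussian_noise \<tau>) borel (\<lambda>(x, y). x + y)) X =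
      (\<integral>\<^sup>+z. indicator X z \<partial>distr (gaussian_noise \<sigma> \<Otimes>\<^sub>M gaussian_noise \<tau>) borel (\<lambda>(x, y). x + y))"
    by simp
  also have "\<dots> = (\<integral>\<^sup>+p. indicator X (case p of (x, y) \<Rightarrow> x + y) \<partial>(gaussian_noise \<sigma> \<Otimes>\<^sub>M gaussian_noise \<tau>))"
    by (rule nn_integral_distr) simp_all
  also have "\<dots> = (\<integral>\<^sup>+y. \<integral>\<^sup>+x. indicator X (x + y) \<partial>gaussian_noise \<sigma> \<partial>gaussian_noise \<tau>)"
    by (subst G.nn_integral_snd[symmetric]) simp_all
  also have "\<dots> = (\<integral>\<^sup>+y. ?g \<tau> y * (\<integral>\<^sup>+x. ennreal (?g \<sigma> x) * indicator X (x + y) \<partial>lborel) \<partial>lborel)"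
    unfolding gaussian_noise_def by (simp add: nn_integral_density)
  also have "\<dots> = (\<integral>\<^sup>+y. ?g \<tau> y * (\<integral>\<^sup>+z. ennreal (?g \<sigma> (z - y)) * indicator X z \<partial>lborel) \<partial>lborel)"
  proof (rule nn_integral_cong, rule arg_cong2[where f = "(*)", OF refl])
    fix y :: "real^'n"
    show "(\<integral>\<^sup>+x. ennreal (?g \<sigma> x) * indicator X (x + y) \<partial>lborel) =
        (\<integral>\<^sup>+z. ennreal (?g \<sigma> (z - y)) * indicator X z \<partial>lborel)"
      using nn_integral_lborel_translate[of "\<lambda>z. ennreal (?g \<sigma> (z - y)) * indicator X z" y] by simp
  qed
  also have "\<dots> = (\<integral>\<^sup>+y. \<integral>\<^sup>+z. ?g \<tau> y * (ennreal (?g \<sigma> (z - y)) * indicator X z) \<partial>lborel \<partial>lborel)"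
    by (simp add: nn_integral_cmult)
  also have "\<dots> = (\<integral>\<^sup>+z. \<integral>\<^sup>+y. ?g \<tau> y * (ennreal (?g \<sigma> (z - y)) * indicator X z) \<partial>lborel \<partial>lborel)"
    by (rule lborel_pair.Fubini') (simp del: vector_minus_component)
  also have "\<dots> = (\<integral>\<^sup>+z. (\<integral>\<^sup>+y. ennreal (?g \<sigma> (z - y)) * ennreal (?g \<tau> y) \<partial>lborel) * indicator X z \<partial>lborel)"
    by (simp add: nn_integral_cmult ac_simps del: vector_minus_component)
  also have "\<dots> = (\<integral>\<^sup>+z. ennreal (?g (sqrt (\<sigma>\<^sup>2 + \<tau>\<^sup>2)) z) * indicator X z \<partial>lborel)"
  proof (intro nn_integral_cong arg_cong2[where f = "(*)"] refl)
    fix z :: "real^'n"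
    have "(\<integral>\<^sup>+y. ennreal (?g \<sigma> (z - y)) * ennreal (?g \<tau> y) \<partial>lborel) =
      (\<integral>\<^sup>+y. (\<Prod>i\<in>UNIV. ennreal (normal_density 0 \<sigma> (z $ i - y $ i) * normal_density 0 \<tau> (y $ i))) \<partial>lborel)"
      by (simp add: prod_ennreal prod.distrib ennreal_mult prod_nonneg)
    also have "\<dots> = (\<Prod>i\<in>UNIV. \<integral>\<^sup>+y. ennreal (normal_density 0 \<sigma> (z $ i - y) * normal_density 0 \<tau> y) \<partial>lborel)"
      by (subst nn_integral_lborel_vec_prod) simp_all
    also have "\<dots> = (\<Prod>i\<in>UNIV. ennreal (normal_density 0 (sqrt (\<sigma>\<^sup>2 + \<tau>\<^sup>2)) (z $ i)))"
      using fun_cong[OF conv_normal_density_zero_mean[OF \<sigma> \<tau>]] by simp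
    finally show "(\<integral>\<^sup>+y. ennreal (?g \<sigma> (z - y)) * ennreal (?g \<tau> y) \<partial>lborel) = ennreal (?g (sqrt (\<sigma>\<^sup>2 + \<tau>\<^sup>2)) z)"
      by (simp add: prod_ennreal)
  qed
  also have "\<dots> = emeasure (gaussian_noise (sqrt (\<sigma>\<^sup>2 + \<tau>\<^sup>2))) X"
    by (simp add: gaussian_noise_def emeasure_density)
  finally show "emeasure (distr (gaussian_noise \<sigma> \<Otimes>\<^sub>M gaussian_noise \<tau>) borel (\<lambda>(x, y). x + y)) X =
      emeasure (gaussian_noise (sqrt (\<sigma>\<^sup>2 + \<tau>\<^sup>2))) X" .
qed simp

section \<open>Lattice partition channels\<close>

text \<open>There are uncountably many coefficient functions, but only their values on the finite
  basis matter. Countability underlies the measurability of reduction and the covering by null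
  sets.\<close>

lemma countable_full_rank_lattice:
  fixes L :: "(real^'n) set"
  assumes "full_rank_lattice L" shows "countable L"
proof -
  obtain B where B: "independent B" and L: "L = {(\<Sum>b\<in>B. of_int (c b) *\<^sub>R b) | c :: real^'n \<Rightarrow> int. True}"
    using assms by (auto simp: full_rank_lattice_def)
  have "L \<subseteq> (\<lambda>c. \<Sum>b\<in>B. of_int (c b) *\<^sub>R b) ` (B \<rightarrow>\<^sub>E (UNIV :: int set))"
  proof
    fix x assume "x \<in> L"
    then obtain c :: "real^'n \<Rightarrow> int" where "x = (\<Sum>b\<in>B. of_int (c b) *\<^sub>R b)" by (auto simp: L)
    then have "x = (\<Sum>b\<in>B. of_int (restrict c B b) *\<^sub>R b)" by simp
    then show "x \<in> (\<lambda>c. \<Sum>b\<in>B. of_int (c b) *\<^sub>R b) ` (B \<rightarrow>\<^sub>E (UNIV :: int set))"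
      by (intro image_eqI[of _ _ "restrict c B"]) auto
  qed
  moreover have "countable (B \<rightarrow>\<^sub>E (UNIV :: int set))"
    using independent_imp_finite[OF B] by (intro countable_PiE) auto
  ultimately show ?thesis by (meson countable_image countable_subset)
qed

lemma full_rank_lattice_diff:
  fixes L :: "(real^'n) set"
  assumes "full_rank_lattice L" "x \<in> L" "y \<in> L" shows "x - y \<in> L"
proof -
  obtain B where L: "L = {(\<Sum>b\<in>B. of_int (c b) *\<^sub>R b) | c :: real^'n \<Rightarrow> int. True}"
    using assms(1) by (auto simp: full_rank_lattice_def)
  obtain c d :: "real^'n \<Rightarrow> int" where "x = (\<Sum>b\<in>B. of_int (c b) *\<^sub>R b)" "y = (\<Sum>b\<in>B. of_int (d b) *\<^sub>R b)"
    using assms(2,3) by (auto simp: L)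
  then have "x - y = (\<Sum>b\<in>B. of_int (c b - d b) *\<^sub>R b)"
    by (simp add: sum_subtractf scaleR_diff_left)
  then show ?thesis unfolding L by (intro CollectI exI[of _ "\<lambda>b. c b - d b"]) simp
qed

lemma full_rank_lattice_zero:
  fixes L :: "(real^'n) set"
  assumes "full_rank_lattice L" shows "0 \<in> L"
proof -
  obtain B where L: "L = {(\<Sum>b\<in>B. of_int (c b) *\<^sub>R b) | c :: real^'n \<Rightarrow> int. True}"
    using assms by (auto simp: full_rank_lattice_def)
  show ?thesis unfolding L by (intro CollectI exI[of _ "\<lambda>_. 0"]) simp
qed

lemma full_rank_lattice_uminus:
  assumes "full_rank_lattice L" "x \<in> L" shows "- x \<in> L"
  using full_rank_lattice_diff[OF assms(1) full_rank_lattice_zero[OF assms(1)] assms(2)] by simp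

text \<open>Otherwise 0, \<open>a\<close> and \<open>b\<close> would represent three different
  cosets. This makes the channel insensitive to which representative outside the sublattice carries
  the bit 1.\<close>

lemma lattice_index_2_diff:
  assumes L: "full_rank_lattice L" and L': "full_rank_lattice L'"
    and index: "lattice_index L L' = 2" and a: "a \<in> L - L'" and b: "b \<in> L - L'"
  shows "a - b \<in> L'"
proof (rule ccontr)
  define R where "R = {(x, y). x \<in> L \<and> y \<in> L \<and> x - y \<in> L'}"
  have refl: "x \<in> R `` {x}" if "x \<in> L" for x
    using that full_rank_lattice_zero[OF L'] by (simp add: R_def)
  have neq: "R `` {x} \<noteq> R `` {y}" if "y \<in> L" "x - y \<notin> L'" for x y
    using refl[of y] that by (auto simp: R_def)
  assume ab: "a - b \<notin> L'"
  have "a \<notin> L'" "b \<notin> L'" using a b by auto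
  then have "0 - a \<notin> L'" "0 - b \<notin> L'" using full_rank_lattice_uminus[OF L'] by fastforce+
  then have "card {R `` {0}, R `` {a}, R `` {b}} = 3"
    using neq[of a 0] neq[of b 0] neq[of b a] a b ab by auto
  moreover have "{R `` {0}, R `` {a}, R `` {b}} \<subseteq> L // R"
    using a b full_rank_lattice_zero[OF L] by (auto intro: quotientI)
  moreover have "card (L // R) = 2" using index by (simp add: lattice_index_def R_def)
  ultimately show False
    using card_mono[of "L // R" "{R `` {0}, R `` {a}, R `` {b}}"] card.infinite[of "L // R"]
    by (cases "finite (L // R)") auto
qed

lemma lattice_mod:
  assumes "fundamental_region L D"
  shows "lattice_mod L D x \<in> D" "x - lattice_mod L D x \<in> L"
  using theI'[of "\<lambda>y. y \<in> D \<and> x - y \<in> L"] assms by (auto simp: fundamental_region_def lattice_mod_def)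

lemma lattice_mod_eqI:
  assumes "fundamental_region L D" "y \<in> D" "x - y \<in> L"
  shows "lattice_mod L D x = y"
  using assms lattice_mod[OF assms(1), of x] unfolding fundamental_region_def by metis

lemma lattice_mod_cong:
  assumes L: "full_rank_lattice L" and D: "fundamental_region L D" and xy: "x - y \<in> L"
  shows "lattice_mod L D x = lattice_mod L D y"
proof (rule lattice_mod_eqI[OF D lattice_mod(1)[OF D]])
  have "x - lattice_mod L D y = (x - y) - - (y - lattice_mod L D y)" by simp
  also have "\<dots> \<in> L"
    using full_rank_lattice_diff[OF L xy full_rank_lattice_uminus[OF L lattice_mod(2)[OF D]]] .
  finally show "x - lattice_mod L D y \<in> L" .
qed

text \<open>The preimage of \<open>A\<close> is the union of the translates of
  \<open>A \<inter> D\<close> by lattice vectors, a countable union.\<close>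

lemma measurable_lattice_mod:
  fixes L :: "(real^'n) set"
  assumes L: "full_rank_lattice L" and D: "fundamental_region L D"
  shows "lattice_mod L D \<in> borel_measurable borel"
proof (rule measurableI)
  fix A :: "(real^'n) set" assume [measurable]: "A \<in> sets borel"
  have [measurable]: "D \<in> sets borel" using D by (simp add: fundamental_region_def)
  have "lattice_mod L D -` A \<inter> space borel = (\<Union>w\<in>L. (\<lambda>x. x - w) -` (A \<inter> D))"
  proof safe
    fix x assume "lattice_mod L D x \<in> A"
    then show "x \<in> (\<Union>w\<in>L. (\<lambda>x. x - w) -` (A \<inter> D))"
      using lattice_mod[OF D, of x] by (intro UN_I[of "x - lattice_mod L D x"]) auto
  next
    fix x w assume "w \<in> L" "x - w \<in> A" "x - w \<in> D"
    then show "x \<in> lattice_mod L D -` A"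
      using lattice_mod_eqI[OF D, of "x - w" x] by simp
  qed simp
  also have "\<dots> \<in> sets borel"
    using countable_full_rank_lattice[OF L]
    by (intro sets.countable_UN') (auto intro!: measurable_sets_borel[where M = borel])
  finally show "lattice_mod L D -` A \<inter> space borel \<in> sets borel" .
qed simp

section \<open>Densities of partition channels\<close>

lemma prob_space_partition_channel:
  assumes L: "full_rank_lattice L" and D: "fundamental_region L D" and \<sigma>: "0 < \<sigma>"
  shows "prob_space (partition_channel L D a \<sigma> x)"
  unfolding partition_channel_def using measurable_lattice_mod[OF L D]
  by (intro prob_space.prob_space_distr prob_space_gaussian_noise \<sigma>) simp

text \<open>Makes the Radon-Nikodym derivative a genuine density. Reduction only translates by
  lattice vectors, so the preimage of a null set is covered by countably many translates of
  it.\<close>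

lemma absolutely_continuous_partition_channel:
  fixes L :: "(real^'n) set"
  assumes L: "full_rank_lattice L" and D: "fundamental_region L D"
  shows "absolutely_continuous lborel (partition_channel L D a \<sigma> x)"
  unfolding absolutely_continuous_def
proof
  fix A :: "(real^'n) set" assume A: "A \<in> null_sets lborel"
  then have [measurable]: "A \<in> sets borel" by auto
  note [measurable] = measurable_lattice_mod[OF L D]
  define c where "c = (if x = 1 then a else 0)"
  let ?B = "(\<lambda>e. lattice_mod L D (c + e)) -` A"
  have translate: "(\<lambda>e. e + d) -` A \<in> null_sets lborel" for d
  proof -
    have "emeasure lborel ((\<lambda>e. e + d) -` A) = (\<integral>\<^sup>+e. indicator A (e + d) \<partial>lborel)"
      using measurable_sets_borel[of "\<lambda>e. e + d" borel A]
      by (simp add: nn_integral_indicator[symmetric] indicator_def del: nn_integral_indicator)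
    also have "\<dots> = 0"
      using A by (subst nn_integral_lborel_translate) auto
    finally show ?thesis using measurable_sets_borel[of "\<lambda>e. e + d" borel A] by auto
  qed
  have "(\<Union>w\<in>L. (\<lambda>e. e + (c - w)) -` A) \<in> null_sets lborel"
    using countable_full_rank_lattice[OF L] translate by (rule null_sets_UN')
  moreover have "?B \<subseteq> (\<Union>w\<in>L. (\<lambda>e. e + (c - w)) -` A)"
  proof
    fix e assume "e \<in> ?B"
    then show "e \<in> (\<Union>w\<in>L. (\<lambda>e. e + (c - w)) -` A)"
      using lattice_mod(2)[OF D, of "c + e"]
      by (intro UN_I[of "c + e - lattice_mod L D (c + e)"]) auto
  qed
  moreover have B: "?B \<in> sets borel"
    using measurable_sets_borel[of "\<lambda>e. lattice_mod L D (c + e)" borel A] by simp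
  ultimately have "?B \<in> null_sets lborel" by (metis null_sets_subset sets_lborel)
  moreover have "absolutely_continuous lborel (gaussian_noise \<sigma> :: (real^'n) measure)"
    unfolding gaussian_noise_def by (rule absolutely_continuousI_density) simp
  ultimately have "?B \<in> null_sets (gaussian_noise \<sigma>)" by (auto simp: absolutely_continuous_def)
  then show "A \<in> null_sets (partition_channel L D a \<sigma> x)"
    unfolding partition_channel_def c_def[symmetric]
    by (simp add: null_sets_def emeasure_distr)
qed

text \<open>\<open>enn2real\<close> turns an infinite value of the derivative into 0; since the
  derivative is finite almost everywhere, the measure is unaffected.\<close>

lemma density_partition_density:
  assumes L: "full_rank_lattice L" and D: "fundamental_region L D" and \<sigma>: "0 < \<sigma>"
  shows "density lborel (partition_density L D a \<sigma> x) = partition_channel L D a \<sigma> x"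
proof -
  let ?P = "partition_channel L D a \<sigma> x"
  interpret P: prob_space ?P by (rule prob_space_partition_channel[OF assms])
  have sets: "sets ?P = sets lborel" by (simp add: partition_channel_def)
  note ac = absolutely_continuous_partition_channel[OF L D, of a \<sigma> x]
  have "AE y in lborel. RN_deriv lborel ?P y \<noteq> \<infinity>"
    using ac sets by (intro sigma_finite_measure.RN_deriv_finite) unfold_locales
  then have "density lborel (partition_density L D a \<sigma> x) = density lborel (RN_deriv lborel ?P)"
    unfolding partition_density_def
    by (intro density_cong) (auto simp: top.not_eq_extremum)
  also have "\<dots> = ?P"
    using ac sets by (intro sigma_finite_measure.density_RN_deriv) unfold_locales
  finally show ?thesis .
qed

lemma partition_density_nonneg: "0 \<le> partition_density L D a \<sigma> x y"
  by (simp add: partition_density_def)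

lemma measurable_partition_density [measurable]: "partition_density L D a \<sigma> x \<in> borel_measurable borel"
  unfolding partition_density_def
  using borel_measurable_RN_deriv[of lborel "partition_channel L D a \<sigma> x"] by simp

text \<open>Pulled back along T, the noise of the channel for \<open>T ` L\<close> has standard deviation
  \<open>\<sigma> / \<alpha>\<close>; the kernel adds the missing variance and reduces modulo L.\<close>

lemma degraded_partition_channel:
  fixes L :: "(real^'n) set" and V T :: "real^'n \<Rightarrow> real^'n" and \<alpha> :: real
  defines "T \<equiv> \<lambda>x. \<alpha> *\<^sub>R V x"
  assumes \<alpha>: "1 < \<alpha>" and V: "orthogonal_transformation V" and \<sigma>: "0 < \<sigma>"
    and L: "full_rank_lattice L" and D: "fundamental_region L D"
    and TL: "full_rank_lattice (T ` L)" and D': "fundamental_region (T ` L) D'"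
    and ab: "b - a \<in> L"
  shows "degraded_channel lborel (partition_density (T ` L) D' (T b) \<sigma>)
    lborel (partition_density L D a \<sigma>) (gaussian_noise (sqrt (\<sigma>\<^sup>2 - (\<sigma> / \<alpha>)\<^sup>2)))
    (\<lambda>(y, e). lattice_mod L D ((1 / \<alpha>) *\<^sub>R inv V y + e))"
proof -
  let ?\<tau> = "sqrt (\<sigma>\<^sup>2 - (\<sigma> / \<alpha>)\<^sup>2)"
  let ?G = "gaussian_noise \<sigma> :: (real^'n) measure" and ?K = "gaussian_noise ?\<tau> :: (real^'n) measure"
  \<comment> \<open>The inverse of \<open>T\<close>.\<close>
  define S where "S y = (1 / \<alpha>) *\<^sub>R inv V y" for y
  let ?\<phi> = "\<lambda>(y, e). lattice_mod L D (S y + e)"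
  have inv: "orthogonal_transformation (inv V)" by (rule orthogonal_transformation_inv[OF V])
  note [measurable] = measurable_lattice_mod[OF L D] measurable_lattice_mod[OF TL D']
    borel_measurable_orthogonal_transformation[OF inv]
  have [measurable]: "S \<in> borel_measurable borel" unfolding S_def by measurable
  have ST: "S (T x) = x" for x
    using \<alpha> orthogonal_transformation_inj[OF V] orthogonal_transformation_linear[OF inv]
    by (simp add: S_def T_def linear_cmul)
  have S_add: "S (x + y) = S x + S y" and S_diff: "S (x - y) = S x - S y" and S_0: "S 0 = 0" for x y
    using orthogonal_transformation_linear[OF inv]
    by (simp_all add: S_def linear_add linear_diff linear_0 scaleR_add_right scaleR_diff_right)
  \<comment> \<open>Here \<alpha> > 1 is used: the variance missing after the pullback is positive,
    so the kernel is a genuine Gaussian.\<close>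
  have "\<sigma> / \<alpha> < \<sigma>" using \<alpha> \<sigma> by (simp add: field_simps)
  then have "(\<sigma> / \<alpha>)\<^sup>2 < \<sigma>\<^sup>2" using \<alpha> \<sigma> by (intro power_strict_mono) simp_all
  then have \<tau>: "0 < ?\<tau>" "(\<sigma> / \<alpha>)\<^sup>2 + ?\<tau>\<^sup>2 = \<sigma>\<^sup>2" by simp_all
  interpret K: prob_space ?K by (rule prob_space_gaussian_noise[OF \<tau>(1)])
  have "distr ?G borel S = distr (distr ?G borel (inv V)) borel (\<lambda>x. (1 / \<alpha>) *\<^sub>R x)"
    by (simp add: distr_distr o_def S_def[abs_def])
  also have "\<dots> = gaussian_noise (\<sigma> / \<alpha>)"
    using \<alpha> \<sigma> by (simp add: distr_gaussian_noise_orthogonal[OF inv] distr_gaussian_noise_scaleR)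
  finally have distr_S: "distr ?G borel S = gaussian_noise (\<sigma> / \<alpha>)" .
  \<comment> \<open>Writing \<open>?K\<close> as its own image under the identity brings pairs in
    which only the first component is mapped into the shape of
    \<open>pair_measure_distr\<close>.\<close>
  have K_id: "distr ?K N (\<lambda>e. e) = ?K" if "sets N = sets borel" for N
    using that by (intro distr_id2) simp
  have sum: "distr (?G \<Otimes>\<^sub>M ?K) borel (\<lambda>(e, e'). S e + e') = gaussian_noise \<sigma>"
  proof -
    have "distr ?G borel S \<Otimes>\<^sub>M distr ?K borel (\<lambda>e. e) =
        distr (?G \<Otimes>\<^sub>M ?K) (borel \<Otimes>\<^sub>M borel) (\<lambda>(e, e'). (S e, e'))"
      by (rule pair_measure_distr) (simp_all add: K_id K.sigma_finite_measure_axioms)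
    then have "distr (?G \<Otimes>\<^sub>M ?K) borel (\<lambda>(e, e'). S e + e') =
        distr (gaussian_noise (\<sigma> / \<alpha>) \<Otimes>\<^sub>M ?K) borel (\<lambda>(e, e'). e + e')"
      by (simp add: distr_S K_id distr_distr o_def split_beta')
    also have "\<dots> = gaussian_noise (sqrt ((\<sigma> / \<alpha>)\<^sup>2 + ?\<tau>\<^sup>2))"
      using \<alpha> \<sigma> \<tau>(1) by (intro distr_gaussian_noise_add) simp_all
    also have "\<dots> = gaussian_noise \<sigma>" unfolding \<tau>(2) using \<sigma> by simp
    finally show ?thesis .
  qed
  have push: "partition_channel L D a \<sigma> x = distr (partition_channel (T ` L) D' (T b) \<sigma> x \<Otimes>\<^sub>M ?K) lborel ?\<phi>" for x
  proof -
    define c where "c = (if x = 1 then a else 0)"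
    define c' where "c' = (if x = 1 then T b else 0)"
    let ?f = "\<lambda>e. lattice_mod (T ` L) D' (c' + e)"
    have eq: "lattice_mod L D (S (?f e) + e') = lattice_mod L D (c + (S e + e'))" for e e'
    proof (rule lattice_mod_cong[OF L D])
      obtain w where w: "w \<in> L" "c' + e - ?f e = T w"
        using lattice_mod(2)[OF D', of "c' + e"] by auto
      have "S c' - c \<in> L"
        using ab full_rank_lattice_zero[OF L] by (simp add: c_def c'_def ST S_0)
      moreover have "S (?f e) = S c' + S e - w"
        using arg_cong[OF w(2), of S] by (simp add: S_add S_diff ST) (simp add: algebra_simps)
      then have "S (?f e) + e' - (c + (S e + e')) = (S c' - c) - w" by simp
      ultimately show "S (?f e) + e' - (c + (S e + e')) \<in> L"
        using full_rank_lattice_diff[OF L _ w(1)] by metis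
    qed
    have "distr ?G lborel ?f \<Otimes>\<^sub>M distr ?K borel (\<lambda>e. e) =
        distr (?G \<Otimes>\<^sub>M ?K) (lborel \<Otimes>\<^sub>M borel) (\<lambda>(e, e'). (?f e, e'))"
      by (rule pair_measure_distr) (simp_all add: K_id K.sigma_finite_measure_axioms)
    then have "distr (distr ?G lborel ?f \<Otimes>\<^sub>M ?K) lborel ?\<phi> =
        distr (?G \<Otimes>\<^sub>M ?K) lborel (\<lambda>(e, e'). lattice_mod L D (S (?f e) + e'))"
      by (simp add: K_id distr_distr o_def split_beta')
    \<comment> \<open>What remains depends on the two noises only through \<open>S e + e'\<close>,
      whose law is given by \<open>sum\<close>.\<close>
    also have "\<dots> = distr (distr (?G \<Otimes>\<^sub>M ?K) borel (\<lambda>(e, e'). S e + e')) lborel (\<lambda>e. lattice_mod L D (c + e))"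
      unfolding eq by (simp add: distr_distr o_def split_beta')
    finally show ?thesis
      by (simp add: sum partition_channel_def c_def c'_def)
  qed
  have fin: "finite_measure (partition_channel (T ` L) D' (T b) \<sigma> x)" for x
    using prob_space_partition_channel[OF TL D' \<sigma>] by (simp add: prob_space_def)
  have "degraded_channel lborel (partition_density (T ` L) D' (T b) \<sigma>)
      lborel (partition_density L D a \<sigma>) ?K ?\<phi>"
  proof (rule degraded_channel.intro)
    show "density lborel (partition_density L D a \<sigma> x) =
        distr (density lborel (partition_density (T ` L) D' (T b) \<sigma> x) \<Otimes>\<^sub>M ?K) lborel ?\<phi>" for x
      by (simp only: density_partition_density L D TL D' \<sigma> push[symmetric])
  qed (simp_all add: K.prob_space_axioms lborel.sigma_finite_measure_axioms fin
        density_partition_density[OF TL D' \<sigma>] partition_density_nonneg)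
  then show ?thesis by (simp add: S_def)
qed

section \<open>Nesting of consecutive component codes\<close>

theorem lemma4:
  fixes \<Lambda> :: "nat \<Rightarrow> (real^'n) set"
    and a :: "nat \<Rightarrow> real^'n"
    and D :: "nat \<Rightarrow> (real^'n) set"
    and W :: "nat \<Rightarrow> bit \<Rightarrow> real^'n \<Rightarrow> real"
    and I :: "nat \<Rightarrow> nat set"
    and r m :: nat
    and \<sigma> \<tau> :: real
  assumes chain: "self_similar_chain \<Lambda> r"
    and coset: "\<forall>l\<in>{1..r}. a l \<in> \<Lambda> (l - 1) - \<Lambda> l"
    and region: "\<forall>l\<in>{1..r}. fundamental_region (\<Lambda> l) (D l)"
    and sigma: "\<sigma> > 0"
    and channel: "\<forall>l\<in>{1..r}. W l = partition_density (\<Lambda> l) (D l) (a l) \<sigma>"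
    and tau: "\<tau> > 0"
    and rule: "(\<forall>l\<in>{1..r}. I l = info_set_Z m lborel (W l) \<tau>) \<or>
               (\<forall>l\<in>{1..r}. I l = info_set_Pe m lborel (W l) \<tau>)"
  shows "\<forall>l\<in>{1..<r}. polar_code m (I l) \<subseteq> polar_code m (I (l + 1))"
proof
  fix l assume l: "l \<in> {1..<r}"
  then have l': "l \<in> {1..r}" "l + 1 \<in> {1..r}" "l - 1 \<le> r" "l \<le> r" "l + 1 \<le> r" by auto
  have lattice: "full_rank_lattice (\<Lambda> k)" if "k \<le> r" for k
    using chain that by (auto simp: self_similar_chain_def)
  have index: "lattice_index (\<Lambda> (l - 1)) (\<Lambda> l) = 2"
    using chain l' by (auto simp: self_similar_chain_def)
  obtain \<alpha> V where \<alpha>: "1 < \<alpha>" and V: "orthogonal_transformation V"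
    and sim: "\<forall>l\<le>r. \<Lambda> l = ((\<lambda>x. \<alpha> *\<^sub>R V x) ^^ l) ` \<Lambda> 0"
    using chain by (auto simp: self_similar_chain_def)
  define T where "T = (\<lambda>x. \<alpha> *\<^sub>R V x)"
  have step: "\<Lambda> (Suc k) = T ` \<Lambda> k" if "Suc k \<le> r" for k
    unfolding sim[rule_format, OF that] sim[rule_format, OF Suc_leD[OF that]]
    by (simp add: T_def image_comp)
  have step_l: "\<Lambda> (l + 1) = T ` \<Lambda> l" using step[of l] l' by simp
  have step_pred: "\<Lambda> l = T ` \<Lambda> (l - 1)" using step[of "l - 1"] l by simp
  have "a (l + 1) \<in> \<Lambda> l - \<Lambda> (l + 1)" using coset l'(2) by force
  \<comment> \<open>Pulling \<open>a (l + 1)\<close> back along \<open>T\<close> gives a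
    representative of the same nontrivial coset as \<open>a l\<close>, though perhaps a different
    one; only the difference modulo \<open>\<Lambda> l\<close> matters.\<close>
  then obtain b where b: "b \<in> \<Lambda> (l - 1) - \<Lambda> l" and ab: "a (l + 1) = T b"
    using step_l step_pred by auto
  have "b - a l \<in> \<Lambda> l"
    using coset l' by (intro lattice_index_2_diff[OF lattice lattice index b]) auto
  moreover have "fundamental_region (T ` \<Lambda> l) (D (l + 1))"
    unfolding step_l[symmetric] using region l'(2) by blast
  ultimately have "degraded_channel lborel (partition_density (T ` \<Lambda> l) (D (l + 1)) (T b) \<sigma>)
      lborel (partition_density (\<Lambda> l) (D l) (a l) \<sigma>) (gaussian_noise (sqrt (\<sigma>\<^sup>2 - (\<sigma> / \<alpha>)\<^sup>2)))
      (\<lambda>(y, e). lattice_mod (\<Lambda> l) (D l) ((1 / \<alpha>) *\<^sub>R inv V y + e))"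
    using region l' lattice[of l] lattice[of "l + 1"] unfolding step_l T_def
    by (intro degraded_partition_channel \<alpha> V sigma) auto
  moreover have "W (l + 1) = partition_density (T ` \<Lambda> l) (D (l + 1)) (T b) \<sigma>"
    unfolding ab[symmetric] step_l[symmetric] using channel l'(2) by blast
  moreover have "W l = partition_density (\<Lambda> l) (D l) (a l) \<sigma>"
    using channel l'(1) by blast
  ultimately have deg: "degraded_channel lborel (W (l + 1)) lborel (W l)
      (gaussian_noise (sqrt (\<sigma>\<^sup>2 - (\<sigma> / \<alpha>)\<^sup>2)))
      (\<lambda>(y, e). lattice_mod (\<Lambda> l) (D l) ((1 / \<alpha>) *\<^sub>R inv V y + e))"
    by simp
  \<comment> \<open>Level l + 1 is the better channel, hence the direction. Either alternative of
    \<open>rule\<close> applies one criterion and one threshold to both levels, which makes the two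
    sets comparable.\<close>
  have "I l \<subseteq> I (l + 1)"
    using rule info_set_mono(1)[OF deg, of m \<tau>] info_set_mono(2)[OF deg, of m \<tau>] l'(1,2) by auto
  moreover have "finite (I (l + 1))"
    using rule l' by (auto simp: info_set_Z_def info_set_Pe_def)
  ultimately show "polar_code m (I l) \<subseteq> polar_code m (I (l + 1))" by (rule polar_code_mono)
qed

end
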